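(* For all integers $k\geqslant 0$ and $n$ with $1\leqslant n\leqslant k+1$, there is a profinite group $G(n,k)$ such that the number of primes $p$ for which $p^\infty$ divides the order $o(G(n,k))$ equals $k$, and $\mathrm{ht}(\mathcal{S}(G(n,k)))=n$.
   Context: For a profinite group $G$, $\mathcal{S}(G)$ is the set of closed subgroups of $G$ with its natural profinite topology: a base of open neighbourhoods of $H\in\mathcal{S}(G)$ is given by the sets $B(H,N)=\{K \text{ closed subgroup of } G \mid KN=HN\}$, with $N$ ranging over the open normal subgroups of $G$. The order $o(G)$ is the supernatural number given by the least common multiple of the orders of the finite continuous quotients of $G$. For a space $X$, let $X'$ be $X$ minus its isolated points, $X^{(0)}=X$, $X^{(\alpha+1)}=(X^{(\alpha)})'$, and $X^{(\lambda)}=\bigcap_{\mu<\lambda}X^{(\mu)}$ for limit ordinals $\lambda$. The scattered height $\mathrm{ht}(X)$ is the least ordinal $\lambda$ such that $X^{(\lambda)}=X^{(\lambda+1)}$. *)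

theory Defs
  imports
    "HOL-Analysis.Analysis"
    "HOL-Algebra.Coset"
    "HOL-Library.Extended_Nat"
    "HOL-Computational_Algebra.Primes"
begin

section \<open>Profinite groups\<close>

text \<open>
  A topological group is given by a group \<open>G\<close> and an abstract topology \<open>T\<close> on its carrier;
  profinite means compact, Hausdorff and totally disconnected.
\<close>

definition topological_group :: "('a, 'b) monoid_scheme \<Rightarrow> 'a topology \<Rightarrow> bool" where
  "topological_group G T \<longleftrightarrow>
     group G \<and> topspace T = carrier G \<and>
     continuous_map (prod_topology T T) T (\<lambda>(x, y). x \<otimes>\<^bsub>G\<^esub> y) \<and>
     continuous_map T T (\<lambda>x. inv\<^bsub>G\<^esub> x)"

definition totally_disconnected_space :: "'a topology \<Rightarrow> bool" where
  "totally_disconnected_space T \<longleftrightarrow> (\<forall>S. connectedin T S \<longrightarrow> (\<exists>x. S \<subseteq> {x}))"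

definition profinite_group :: "('a, 'b) monoid_scheme \<Rightarrow> 'a topology \<Rightarrow> bool" where
  "profinite_group G T \<longleftrightarrow>
     topological_group G T \<and> compact_space T \<and> Hausdorff_space T \<and> totally_disconnected_space T"

definition open_normal_subgroups :: "('a, 'b) monoid_scheme \<Rightarrow> 'a topology \<Rightarrow> 'a set set" where
  "open_normal_subgroups G T = {N. N \<lhd> G \<and> openin T N}"


section \<open>The order as a supernatural number\<close>

text \<open>
  A supernatural number \<open>\<Prod>\<^sub>p p\<^sup>e\<^sup>(\<^sup>p\<^sup>)\<close> is represented by its exponent function \<open>e\<close> with values in
  \<open>\<nat> \<union> {\<infinity>}\<close>, set to 0 at non-primes. The least common multiple is the pointwise supremum.
\<close>

type_synonym supernatural = "nat \<Rightarrow> enat"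

definition supernatural_of_nat :: "nat \<Rightarrow> supernatural" where
  "supernatural_of_nat m = (\<lambda>p. if prime p then enat (multiplicity p m) else 0)"

definition supernatural_lcm :: "nat set \<Rightarrow> supernatural" where
  "supernatural_lcm M = (\<lambda>p. SUP m\<in>M. supernatural_of_nat m p)"

definition profinite_order :: "('a, 'b) monoid_scheme \<Rightarrow> 'a topology \<Rightarrow> supernatural" where
  "profinite_order G T =
     supernatural_lcm {order (G Mod N) |N. N \<in> open_normal_subgroups G T \<and> finite (carrier (G Mod N))}"

definition infinite_primes :: "supernatural \<Rightarrow> nat set" where
  "infinite_primes s = {p. prime p \<and> s p = \<infinity>}"


section \<open>The space of closed subgroups\<close>

definition closed_subgroups :: "('a, 'b) monoid_scheme \<Rightarrow> 'a topology \<Rightarrow> 'a set set" where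
  "closed_subgroups G T = {H. subgroup H G \<and> closedin T H}"

definition subgroup_nbhd ::
    "('a, 'b) monoid_scheme \<Rightarrow> 'a topology \<Rightarrow> 'a set \<Rightarrow> 'a set \<Rightarrow> 'a set set" where
  "subgroup_nbhd G T H N = {K \<in> closed_subgroups G T. K <#>\<^bsub>G\<^esub> N = H <#>\<^bsub>G\<^esub> N}"

definition subgroup_space :: "('a, 'b) monoid_scheme \<Rightarrow> 'a topology \<Rightarrow> 'a set topology" where
  "subgroup_space G T =
     topology_generated_by
       {subgroup_nbhd G T H N |H N. H \<in> closed_subgroups G T \<and> N \<in> open_normal_subgroups G T}"


section \<open>Cantor--Bendixson derivatives and scattered height\<close>

definition isolated_points :: "'a topology \<Rightarrow> 'a set \<Rightarrow> 'a set" where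
  "isolated_points X A = {x \<in> A. openin (subtopology X A) {x}}"

definition remove_isolated :: "'a topology \<Rightarrow> 'a set \<Rightarrow> 'a set" where
  "remove_isolated X A = A - isolated_points X A"

text \<open>
  Ordinals are the elements of a well-ordered type \<open>'o\<close>, an element \<open>a\<close> standing for the order type
  of its set of predecessors; the elements of \<^typ>\<open>nat\<close> are the finite ordinals. The three cases
  are zero, successor and limit.
\<close>

function cb_derivative :: "'a topology \<Rightarrow> 'o::wellorder \<Rightarrow> 'a set" where
  "cb_derivative X a =
     (if {..<a} = {} then topspace X
      else if \<exists>b<a. \<forall>c<a. c \<le> b
        then remove_isolated X (cb_derivative X (GREATEST b. b < a))
      else (\<Inter>b\<in>{..<a}. cb_derivative X b))"
  by pat_completeness auto
termination
proof (relation "{((X, a), (Y, b)). a < b}")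
  have "wf (inv_image {(x, y). x < y} (snd :: 'a topology \<times> 'o::wellorder \<Rightarrow> 'o))"
    by (intro wf_inv_image wf)
  then show "wf {((X :: 'a topology, a), (Y :: 'a topology, b)). (a :: 'o::wellorder) < b}"
    by (rule wf_subset) auto
next
  fix X :: "'a topology" and a :: "'o::wellorder"
  assume "\<exists>b<a. \<forall>c<a. c \<le> b"
  then obtain b where b: "b < a" "\<And>c. c < a \<Longrightarrow> c \<le> b" by blast
  have "(GREATEST b. b < a) = b" using b by (intro Greatest_equality) auto
  with b show "((X, GREATEST b. b < a), (X, a)) \<in> {((X, a), (Y, b)). a < b}" by simp
qed auto

declare cb_derivative.simps [simp del]

text \<open>
  \<open>has_scattered_height X a\<close> means \<open>ht(X) = a\<close>, the derivative following \<open>X\<^sup>(\<^sup>b\<^sup>)\<close> being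
  \<^term>\<open>remove_isolated X (cb_derivative X b)\<close>.
\<close>

definition has_scattered_height :: "'a topology \<Rightarrow> 'o::wellorder \<Rightarrow> bool" where
  "has_scattered_height X a \<longleftrightarrow>
     cb_derivative X a = remove_isolated X (cb_derivative X a) \<and>
     (\<forall>b<a. cb_derivative X b \<noteq> remove_isolated X (cb_derivative X b))"

lemma cb_derivative_0: "cb_derivative X (0::nat) = topspace X"
  by (subst cb_derivative.simps) simp

lemma cb_derivative_Suc: "cb_derivative X (Suc n) = remove_isolated X (cb_derivative X n)"
proof -
  have "(GREATEST b. b < Suc n) = n" by (intro Greatest_equality) auto
  moreover have "\<exists>b<Suc n. \<forall>c<Suc n. c \<le> b" by (intro exI[of _ n]) auto
  moreover have "{..<Suc n} \<noteq> {}" by auto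
  ultimately show ?thesis by (subst cb_derivative.simps) simp
qed


section \<open>The sets \<open>B(H, N)\<close> form a base of neighbourhoods\<close>

context
  fixes G :: "('a, 'b) monoid_scheme" and T :: "'a topology"
  assumes G: "group G" and top: "topspace T = carrier G"
begin

lemma subgroup_nbhd_mono:
  assumes M: "M \<in> open_normal_subgroups G T" and N: "N \<in> open_normal_subgroups G T"
    and "M \<subseteq> N" and H: "H \<in> closed_subgroups G T"
  shows "subgroup_nbhd G T H M \<subseteq> subgroup_nbhd G T H N"
proof
  fix K assume K: "K \<in> subgroup_nbhd G T H M"
  interpret group G by (fact G)
  have sub: "M \<subseteq> carrier G" "N \<subseteq> carrier G" "K \<subseteq> carrier G" "H \<subseteq> carrier G"
    using M N K H subgroup.subset[of _ G]
    unfolding open_normal_subgroups_def subgroup_nbhd_def closed_subgroups_def normal_def by blast+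
  have sg: "subgroup N G" "subgroup M G"
    using M N unfolding open_normal_subgroups_def normal_def by blast+
  have "M <#>\<^bsub>G\<^esub> N = N"
  proof
    show "M <#>\<^bsub>G\<^esub> N \<subseteq> N" using \<open>M \<subseteq> N\<close> subgroup.m_closed[OF sg(1)] unfolding set_mult_def by blast
    show "N \<subseteq> M <#>\<^bsub>G\<^esub> N"
      using sub subgroup.one_closed[OF sg(2)] by (force simp: set_mult_def)
  qed
  note MN = this
  have "K <#>\<^bsub>G\<^esub> N = (K <#>\<^bsub>G\<^esub> M) <#>\<^bsub>G\<^esub> N"
    using set_mult_assoc[OF sub(3,1,2)] MN by simp
  also have "K <#>\<^bsub>G\<^esub> M = H <#>\<^bsub>G\<^esub> M"
    using K by (simp add: subgroup_nbhd_def)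
  also have "(H <#>\<^bsub>G\<^esub> M) <#>\<^bsub>G\<^esub> N = H <#>\<^bsub>G\<^esub> N"
    using set_mult_assoc[OF sub(4,1,2)] MN by simp
  finally show "K \<in> subgroup_nbhd G T H N"
    using K by (simp add: subgroup_nbhd_def)
qed

lemma open_normal_subgroups_Int:
  assumes "M \<in> open_normal_subgroups G T" "N \<in> open_normal_subgroups G T"
  shows "M \<inter> N \<in> open_normal_subgroups G T"
  using assms group.normal_subgroup_intersect[OF G] openin_Int
  unfolding open_normal_subgroups_def by blast

lemma openin_subgroup_space:
  "openin (subgroup_space G T) U \<longleftrightarrow>
     U \<subseteq> closed_subgroups G T \<and>
     (\<forall>H\<in>U. \<exists>N\<in>open_normal_subgroups G T. subgroup_nbhd G T H N \<subseteq> U)"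
  (is "_ \<longleftrightarrow> ?P U")
proof
  assume "openin (subgroup_space G T) U"
  then have "generate_topology_on
      {subgroup_nbhd G T H N |H N. H \<in> closed_subgroups G T \<and> N \<in> open_normal_subgroups G T} U"
    by (simp add: subgroup_space_def openin_topology_generated_by_iff)
  then show "?P U"
  proof induction
    case Empty then show ?case by simp
  next
    case (Int U V)
    show ?case
    proof (intro conjI ballI)
      fix H assume H: "H \<in> U \<inter> V"
      then obtain M N where MN: "M \<in> open_normal_subgroups G T" "subgroup_nbhd G T H M \<subseteq> U"
        "N \<in> open_normal_subgroups G T" "subgroup_nbhd G T H N \<subseteq> V"
        using Int by blast
      have "subgroup_nbhd G T H (M \<inter> N) \<subseteq> U \<inter> V"
        using subgroup_nbhd_mono[of "M \<inter> N" M H] subgroup_nbhd_mono[of "M \<inter> N" N H] MN H Int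
          open_normal_subgroups_Int by blast
      then show "\<exists>N\<in>open_normal_subgroups G T. subgroup_nbhd G T H N \<subseteq> U \<inter> V"
        using MN open_normal_subgroups_Int by blast
    qed (use Int in blast)
  next
    case (UN K)
    then show ?case by (blast intro: order_trans)
  next
    case (Basis s)
    then show ?case by (force simp: subgroup_nbhd_def)
  qed
next
  assume P: "?P U"
  then obtain N where N: "\<And>H. H \<in> U \<Longrightarrow> N H \<in> open_normal_subgroups G T"
    "\<And>H. H \<in> U \<Longrightarrow> subgroup_nbhd G T H (N H) \<subseteq> U"
    by metis
  have "openin (subgroup_space G T) (subgroup_nbhd G T H (N H))" if "H \<in> U" for H
    unfolding subgroup_space_def using N P that by (intro topology_generated_by_Basis) blast
  then have "openin (subgroup_space G T) (\<Union>H\<in>U. subgroup_nbhd G T H (N H))"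
    by blast
  moreover have "(\<Union>H\<in>U. subgroup_nbhd G T H (N H)) = U"
    using N P by (auto simp: subgroup_nbhd_def)
  ultimately show "openin (subgroup_space G T) U" by simp
qed

lemma topspace_subgroup_space: "topspace (subgroup_space G T) = closed_subgroups G T"
proof -
  interpret group G by (fact G)
  have "carrier G \<lhd> G"
    unfolding normal_inv_iff using subgroup_self by simp
  moreover have "openin T (carrier G)" by (simp flip: top)
  ultimately have "carrier G \<in> open_normal_subgroups G T"
    by (simp add: open_normal_subgroups_def)
  then have "openin (subgroup_space G T) (closed_subgroups G T)"
    unfolding openin_subgroup_space by (auto simp: subgroup_nbhd_def)
  then show ?thesis
    by (meson openin_subgroup_space openin_subset openin_topspace subset_antisym)
qed

end

end

theory Submission
  imports Defs
    "HOL-Algebra.Sylow" "HOL-Algebra.Multiplicative_Group"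
    "HOL-Number_Theory.Cong"
begin

text \<open>
  Let \<open>m = n - 1\<close> and let \<open>G\<close> be the product of \<open>\<int>\<^sub>p\<close> for \<open>m\<close> primes and of \<open>\<int>\<^sub>p \<times> \<int>\<^sub>p\<close> for \<open>k - m\<close> further
  primes. A closed subgroup \<open>H\<close> is the product of its \<open>p\<close>-components. A component that is open is
  determined by its image modulo a large power of \<open>p\<close> (Nakayama), while the trivial subgroup of
  \<open>\<int>\<^sub>p\<close> is the limit of the subgroups \<open>p\<^sup>r\<int>\<^sub>p\<close>, which are isolated. A subgroup of \<open>\<int>\<^sub>p \<times> \<int>\<^sub>p\<close> that
  is not open is a limit of other such subgroups, for instance of its images under transvections
  congruent to the identity: a subgroup fixed by these is open or trivial. Hence the \<open>t\<close>-th derivative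
  consists of the \<open>H\<close> that have a non-open component in some \<open>\<int>\<^sub>p \<times> \<int>\<^sub>p\<close> or at least \<open>t\<close> trivial
  components in the factors \<open>\<int>\<^sub>p\<close>, and it is stationary exactly from \<open>t = m + 1\<close> on.
\<close>

section \<open>Products of groups of \<open>p\<close>-adic integers\<close>

text \<open>
  An element of \<open>\<Prod>\<^sub>c \<int>\<^sub>p\<close>, with \<open>p = w c\<close>, is given by the residues \<open>coord x c r\<close> of its \<open>c\<close>-th coordinate
  modulo \<open>p\<^sup>r\<close>. The factor is trivial if \<open>w c = 1\<close>.
\<close>

definition coord :: "(nat \<Rightarrow> int) \<Rightarrow> nat \<Rightarrow> nat \<Rightarrow> int" where
  "coord x c r = x (prod_encode (c, r))"

definition of_coords :: "(nat \<Rightarrow> nat \<Rightarrow> int) \<Rightarrow> nat \<Rightarrow> int" where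
  "of_coords f i = case_prod f (prod_decode i)"

text \<open>Reduction modulo \<open>w c ^ s\<close> in every coordinate \<open>c\<close> at once.
  Its fibres will be a base of the topology, so that one number \<open>s\<close> measures every
  approximation.\<close>

definition red :: "nat \<Rightarrow> (nat \<Rightarrow> int) \<Rightarrow> nat \<Rightarrow> int" where
  "red s x = (\<lambda>c. coord x c s)"

lemma coord_of_coords [simp]: "coord (of_coords f) c r = f c r"
  by (simp add: coord_def of_coords_def)

lemma coord_eqI: "(\<And>c r. coord x c r = coord y c r) \<Longrightarrow> x = y"
  unfolding coord_def by (rule ext) (metis prod.exhaust prod_decode_inverse)

definition adic_carrier :: "(nat \<Rightarrow> nat) \<Rightarrow> (nat \<Rightarrow> int) set" where
  "adic_carrier w =
     {x. \<forall>c r. 0 \<le> coord x c r \<and> coord x c r < int (w c) ^ r \<and> coord x c (Suc r) mod int (w c) ^ r = coord x c r}"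

definition adic_group :: "(nat \<Rightarrow> nat) \<Rightarrow> (nat \<Rightarrow> int) monoid" where
  "adic_group w = \<lparr>carrier = adic_carrier w,
     mult = (\<lambda>x y. of_coords (\<lambda>c r. (coord x c r + coord y c r) mod int (w c) ^ r)),
     one = of_coords (\<lambda>c r. 0)\<rparr>"

definition adic_topology :: "(nat \<Rightarrow> nat) \<Rightarrow> (nat \<Rightarrow> int) topology" where
  "adic_topology w =
     subtopology (product_topology (\<lambda>_. discrete_topology UNIV) UNIV) (adic_carrier w)"

text \<open>\<open>fin\<close> leaves finitely many nontrivial factors, which makes the fibres of
  \<open>red s\<close> open and finite in number.\<close>

locale adic =
  fixes w :: "nat \<Rightarrow> nat"
  assumes w_pos [simp]: "\<And>c. w c > 0"
    and fin: "finite {c. w c \<noteq> 1}"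
begin

abbreviation G where "G \<equiv> adic_group w"
abbreviation T where "T \<equiv> adic_topology w"
abbreviation q where "q c r \<equiv> int (w c) ^ r"

section \<open>The coordinatewise group structure\<close>

lemma carrier_G: "carrier G = adic_carrier w"
  by (simp add: adic_group_def)

lemma coord_mult [simp]: "coord (x \<otimes>\<^bsub>G\<^esub> y) c r = (coord x c r + coord y c r) mod q c r"
  by (simp add: adic_group_def)

lemma coord_one [simp]: "coord \<one>\<^bsub>G\<^esub> c r = 0"
  by (simp add: adic_group_def)

lemma mem_carrier:
  "x \<in> carrier G \<longleftrightarrow>
     (\<forall>c r. 0 \<le> coord x c r \<and> coord x c r < q c r \<and> coord x c (Suc r) mod q c r = coord x c r)"
  by (simp add: adic_group_def adic_carrier_def)

lemma coord_mod [simp]: "x \<in> carrier G \<Longrightarrow> coord x c r mod q c r = coord x c r"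
  by (simp add: mem_carrier)

text \<open>Elements can be given by integers \<open>f c r\<close> that are not reduced:
  \<open>q c r\<close> divides \<open>q c (Suc r)\<close>, so coherence modulo \<open>q c r\<close>
  survives the reduction.\<close>

lemma carrierI:
  assumes "\<And>c r. coord x c r = f c r mod q c r" "\<And>c r. [f c (Suc r) = f c r] (mod q c r)"
  shows "x \<in> carrier G"
  unfolding mem_carrier
proof (intro allI conjI)
  fix c r
  show "coord x c (Suc r) mod q c r = coord x c r"
    using assms(2)[of c r] by (simp add: assms(1) cong_def mod_mod_cancel)
qed (simp_all add: assms(1))

lemma coord_Suc_cong: "x \<in> carrier G \<Longrightarrow> [coord x c (Suc r) = coord x c r] (mod q c r)"
  by (simp add: mem_carrier cong_def)

lemma coord_mod_le:
  assumes x: "x \<in> carrier G" and "r \<le> s"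
  shows "coord x c s mod q c r = coord x c r"
  using \<open>r \<le> s\<close>
proof (induction s rule: dec_induct)
  case base
  then show ?case using x by simp
next
  case (step s)
  have "coord x c (Suc s) mod q c r = (coord x c (Suc s) mod q c s) mod q c r"
    using step by (simp add: mod_mod_cancel le_imp_power_dvd)
  also have "coord x c (Suc s) mod q c s = coord x c s" using x by (simp add: mem_carrier)
  finally show ?case using step by simp
qed

lemma coord_trivial: "x \<in> carrier G \<Longrightarrow> w c = 1 \<Longrightarrow> coord x c r = 0"
  unfolding mem_carrier by (smt (verit) of_nat_1 power_one)

lemma red_mono:
  assumes "x \<in> carrier G" "y \<in> carrier G" "r \<le> s" "red s x = red s y"
  shows "red r x = red r y"
  using assms coord_mod_le unfolding red_def fun_eq_iff by metis

lemma mult_closed: "x \<in> carrier G \<Longrightarrow> y \<in> carrier G \<Longrightarrow> x \<otimes>\<^bsub>G\<^esub> y \<in> carrier G"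
  by (rule carrierI[of _ "\<lambda>c r. coord x c r + coord y c r"]) (auto intro: cong_add coord_Suc_cong)

lemma one_carrier: "\<one>\<^bsub>G\<^esub> \<in> carrier G"
  by (simp add: mem_carrier)

definition neg where "neg x = of_coords (\<lambda>c r. (- coord x c r) mod q c r)"

lemma neg_closed: "x \<in> carrier G \<Longrightarrow> neg x \<in> carrier G"
  by (rule carrierI[of _ "\<lambda>c r. - coord x c r"])
    (auto simp: neg_def cong_minus_minus_iff intro: coord_Suc_cong)

lemma neg_mult: "x \<in> carrier G \<Longrightarrow> neg x \<otimes>\<^bsub>G\<^esub> x = \<one>\<^bsub>G\<^esub>"
  by (rule coord_eqI) (simp add: neg_def mod_simps)

sublocale G: comm_group G
proof (rule comm_groupI)
  fix x y z assume x: "x \<in> carrier G" "y \<in> carrier G" "z \<in> carrier G"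
  show "x \<otimes>\<^bsub>G\<^esub> y \<otimes>\<^bsub>G\<^esub> z = x \<otimes>\<^bsub>G\<^esub> (y \<otimes>\<^bsub>G\<^esub> z)"
    by (rule coord_eqI) (simp add: mod_simps add.assoc)
  show "x \<otimes>\<^bsub>G\<^esub> y = y \<otimes>\<^bsub>G\<^esub> x"
    by (rule coord_eqI) (simp add: add.commute)
next
  fix x assume x: "x \<in> carrier G"
  show "\<one>\<^bsub>G\<^esub> \<otimes>\<^bsub>G\<^esub> x = x"
    by (rule coord_eqI) (simp add: x)
  show "\<exists>y\<in>carrier G. y \<otimes>\<^bsub>G\<^esub> x = \<one>\<^bsub>G\<^esub>"
    using x neg_closed neg_mult by blast
qed (simp_all add: mult_closed one_carrier)

lemma coord_inv [simp]: "x \<in> carrier G \<Longrightarrow> coord (inv\<^bsub>G\<^esub> x) c r = (- coord x c r) mod q c r"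
proof -
  assume x: "x \<in> carrier G"
  have "inv\<^bsub>G\<^esub> x = neg x" using x by (intro G.inv_equality) (simp_all add: neg_mult neg_closed)
  then show ?thesis by (simp add: neg_def)
qed

lemma coord_pow [simp]:
  assumes "x \<in> carrier G"
  shows "coord (x [^]\<^bsub>G\<^esub> (t::nat)) c r = (int t * coord x c r) mod q c r"
  using assms by (induction t) (auto simp: mod_simps algebra_simps)

lemma red_mult: "red s x = red s x' \<Longrightarrow> red s y = red s y' \<Longrightarrow> red s (x \<otimes>\<^bsub>G\<^esub> y) = red s (x' \<otimes>\<^bsub>G\<^esub> y')"
  by (simp add: red_def fun_eq_iff)

lemma red_inv: "x \<in> carrier G \<Longrightarrow> x' \<in> carrier G \<Longrightarrow> red s x = red s x' \<Longrightarrow> red s (inv\<^bsub>G\<^esub> x) = red s (inv\<^bsub>G\<^esub> x')"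
  by (simp add: red_def fun_eq_iff)

section \<open>The profinite topology in terms of reductions\<close>

lemma topspace_T: "topspace T = carrier G"
  by (simp add: adic_topology_def adic_group_def)

text \<open>A basic open set of the product constrains finitely many pairs \<open>(c, r)\<close>; by
  compatibility of residues, agreement at the largest of these levels \<open>r\<close> implies
  agreement at all of them. Conversely, \<open>red s\<close> constrains only the finitely many
  nontrivial coordinates.\<close>

lemma openin_T:
  "openin T U \<longleftrightarrow>
     U \<subseteq> carrier G \<and> (\<forall>x\<in>U. \<exists>s. \<forall>y\<in>carrier G. red s y = red s x \<longrightarrow> y \<in> U)"
  (is "_ \<longleftrightarrow> ?R U")
proof
  assume "openin T U"
  then obtain V where V: "openin (product_topology (\<lambda>_. discrete_topology UNIV) UNIV) V"
    "U = V \<inter> carrier G"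
    unfolding adic_topology_def openin_subtopology carrier_G by auto
  show "?R U"
  proof (intro conjI ballI)
    fix x assume x: "x \<in> U"
    then obtain W where W: "finite {i. W i \<noteq> (UNIV :: int set)}" "x \<in> PiE UNIV W" "PiE UNIV W \<subseteq> V"
      using V(1) unfolding openin_product_topology_alt V(2) by fastforce
    define s where "s = Max (insert 0 ((\<lambda>i. snd (prod_decode i)) ` {i. W i \<noteq> UNIV}))"
    show "\<exists>s. \<forall>y\<in>carrier G. red s y = red s x \<longrightarrow> y \<in> U"
    proof (intro exI[of _ s] ballI impI)
      fix y assume y: "y \<in> carrier G" "red s y = red s x"
      have "y i \<in> W i" for i
      proof (cases "W i = UNIV")
        case False
        obtain c r where cr: "prod_decode i = (c, r)" by (cases "prod_decode i") auto
        have "r \<le> s" unfolding s_def using False cr W(1) by (intro Max_ge) (auto intro!: image_eqI[of _ _ i])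
        then have "red r y = red r x" using red_mono y x V(2) by blast
        then have "coord y c r = coord x c r" by (metis red_def)
        then have "y i = x i" unfolding coord_def using cr by (metis prod_decode_inverse)
        then show ?thesis using W(2) by auto
      qed auto
      then show "y \<in> U" using W(3) y(1) V(2) by auto
    qed
  qed (use V in auto)
next
  assume R: "?R U"
  define C where "C = (\<lambda>x s. {y \<in> carrier G. red s y = red s x})"
  have "openin T (C x s)" if "x \<in> carrier G" for x s
  proof -
    let ?W = "\<lambda>i. if fst (prod_decode i) \<in> {c. w c \<noteq> 1} \<and> snd (prod_decode i) = s then {x i} else UNIV"
    have "C x s = PiE UNIV ?W \<inter> carrier G"
    proof (intro equalityI subsetI)
      fix y assume y: "y \<in> C x s"
      have "y i \<in> ?W i" for i
      proof -
        obtain c r where "prod_decode i = (c, r)" by (cases "prod_decode i") auto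
        then show ?thesis using y unfolding C_def red_def coord_def fun_eq_iff
          by (auto dest: spec[of _ c] simp: prod_decode_inverse) (metis prod_decode_inverse)
      qed
      then show "y \<in> PiE UNIV ?W \<inter> carrier G" using y by (auto simp: C_def)
    next
      fix y assume y: "y \<in> PiE UNIV ?W \<inter> carrier G"
      have "coord y c s = coord x c s" for c
      proof (cases "w c = 1")
        case True
        then show ?thesis using y that by (simp add: coord_trivial)
      next
        case False
        have "y (prod_encode (c, s)) \<in> ?W (prod_encode (c, s))" using y by blast
        then show ?thesis using False by (simp add: coord_def)
      qed
      then show "y \<in> C x s" using y by (auto simp: C_def red_def)
    qed
    moreover have "openin (product_topology (\<lambda>_. discrete_topology UNIV) UNIV) (PiE UNIV ?W)"
    proof -
      have "{i. ?W i \<noteq> UNIV} \<subseteq> prod_encode ` ({c. w c \<noteq> 1} \<times> {s})"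
        by (force split: if_splits simp: image_iff intro: prod_decode_inverse[symmetric])
      then have "finite {i. ?W i \<noteq> UNIV}"
        using fin by (meson finite_SigmaI finite.emptyI finite.insertI finite_imageI finite_subset)
      then show ?thesis by (simp add: openin_PiE_gen)
    qed
    ultimately show ?thesis
      unfolding adic_topology_def openin_subtopology carrier_G by blast
  qed
  note C = this
  from R obtain s where s: "\<And>x. x \<in> U \<Longrightarrow> C x (s x) \<subseteq> U" unfolding C_def by (metis (mono_tags, lifting) mem_Collect_eq subsetI)
  have "U = (\<Union>x\<in>U. C x (s x))" using s R by (force simp: C_def)
  moreover have "openin T (\<Union>x\<in>U. C x (s x))" using C R by blast
  ultimately show "openin T U" by simp
qed

lemma openin_red: "openin T {x \<in> carrier G. red s x = f}"
  unfolding openin_T by (intro conjI ballI exI[of _ s]) auto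

lemma closedin_T:
  "closedin T H \<longleftrightarrow>
     H \<subseteq> carrier G \<and> (\<forall>x\<in>carrier G. (\<forall>s. \<exists>h\<in>H. red s h = red s x) \<longrightarrow> x \<in> H)"
proof (cases "H \<subseteq> carrier G")
  case True
  have eq: "(\<forall>y\<in>carrier G. red s y = red s x \<longrightarrow> y \<in> carrier G - H) \<longleftrightarrow> \<not> (\<exists>h\<in>H. red s h = red s x)" for s x
    using True by auto
  show ?thesis
    unfolding closedin_def topspace_T openin_T eq using True by blast
qed (simp add: closedin_def topspace_T)

lemma compact_T: "compact_space T"
proof -
  let ?P = "product_topology (\<lambda>_::nat. discrete_topology (UNIV :: int set)) UNIV"
  let ?S = "\<lambda>i. case prod_decode i of (c, r) \<Rightarrow> {0..<q c r}"
  have "compactin ?P (PiE UNIV ?S)"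
    by (subst compactin_PiE) (auto split: prod.split simp: compactin_discrete_topology)
  moreover have "adic_carrier w \<subseteq> PiE UNIV ?S"
  proof
    fix x assume "x \<in> adic_carrier w"
    then have "x \<in> carrier G" by (simp add: carrier_G)
    then have "coord x c r \<in> {0..<q c r}" for c r by (simp add: mem_carrier)
    then show "x \<in> PiE UNIV ?S"
      by (auto split: prod.split simp: coord_def) (metis prod_decode_inverse)+
  qed
  moreover have "closedin ?P (adic_carrier w)"
  proof -
    have c: "continuous_map ?P (discrete_topology UNIV) (\<lambda>x. x i)" for i
      by (rule continuous_map_product_projection) simp
    have "closedin ?P {x \<in> topspace ?P. x i \<in> A}" for i A
      by (rule closedin_continuous_map_preimage[OF c]) simp
    then have 1: "closedin ?P {x. x i \<in> A}" for i A by simp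
    have 2: "closedin ?P {x. R (x i) (x j)}" for i j and R :: "int \<Rightarrow> int \<Rightarrow> bool"
    proof -
      have "closedin ?P ({x. x i \<in> {a}} \<inter> {x. x j \<in> {b. R a b}} \<union> {x. x i \<in> - {a}})" for a
        by (intro closedin_Un closedin_Int 1)
      then have "closedin ?P (\<Inter>a. {x. x i \<in> {a}} \<inter> {x. x j \<in> {b. R a b}} \<union> {x. x i \<in> - {a}})"
        by blast
      moreover have "(\<Inter>a. {x. x i \<in> {a}} \<inter> {x. x j \<in> {b. R a b}} \<union> {x. x i \<in> - {a}}) = {x. R (x i) (x j)}"
        by auto
      ultimately show ?thesis by simp
    qed
    have "adic_carrier w = (\<Inter>c. \<Inter>r. {x. 0 \<le> coord x c r \<and> coord x c r < q c r \<and> coord x c (Suc r) mod q c r = coord x c r})"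
      by (auto simp: adic_carrier_def)
    moreover have "closedin ?P (\<Inter>c. \<Inter>r. {x. 0 \<le> coord x c r \<and> coord x c r < q c r \<and> coord x c (Suc r) mod q c r = coord x c r})"
      unfolding coord_def by (intro closedin_INT 2) auto
    ultimately show ?thesis by simp
  qed
  ultimately have "compactin ?P (adic_carrier w)" using closed_compactin by blast
  then show ?thesis
    unfolding adic_topology_def by (simp add: compact_space_subtopology)
qed

lemma profinite: "profinite_group G T"
  unfolding profinite_group_def
proof (intro conjI)
  show "Hausdorff_space T" unfolding adic_topology_def
    by (rule Hausdorff_space_subtopology) (simp add: Hausdorff_space_product_topology)
  show "totally_disconnected_space T" unfolding totally_disconnected_space_def
  proof (intro allI impI)
    fix S assume S: "connectedin T S"
    have c: "continuous_map T (discrete_topology UNIV) (\<lambda>x. x i)" for i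
      unfolding adic_topology_def
      by (intro continuous_map_from_subtopology continuous_map_product_projection) simp
    have "\<exists>a. (\<lambda>x. x i) ` S \<subseteq> {a}" for i
      using connectedin_continuous_map_image[OF c S, of i]
      by (auto simp: connectedin_discrete_topology)
    then obtain a where "\<And>i. (\<lambda>x. x i) ` S \<subseteq> {a i}" by metis
    then have "S \<subseteq> {a}" by force
    then show "\<exists>x. S \<subseteq> {x}" by blast
  qed
  show "topological_group G T" unfolding topological_group_def
  proof (intro conjI)
    show "continuous_map (prod_topology T T) T (\<lambda>(x, y). x \<otimes>\<^bsub>G\<^esub> y)"
      unfolding continuous_map_def
    proof (intro conjI allI impI)
      fix U assume U: "openin T U"
      show "openin (prod_topology T T) {z \<in> topspace (prod_topology T T). (case z of (x, y) \<Rightarrow> x \<otimes>\<^bsub>G\<^esub> y) \<in> U}"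
        unfolding openin_prod_topology_alt
      proof (intro allI impI)
        fix x y assume xy: "(x, y) \<in> {z \<in> topspace (prod_topology T T). (case z of (x, y) \<Rightarrow> x \<otimes>\<^bsub>G\<^esub> y) \<in> U}"
        then obtain s where s: "\<And>z. z \<in> carrier G \<Longrightarrow> red s z = red s (x \<otimes>\<^bsub>G\<^esub> y) \<Longrightarrow> z \<in> U"
          using U unfolding openin_T by (metis (mono_tags, lifting) case_prod_conv mem_Collect_eq)
        let ?C = "\<lambda>x. {z \<in> carrier G. red s z = red s x}"
        have "openin T (?C x)" for x by (rule openin_red)
        moreover have "?C x \<times> ?C y \<subseteq> {z \<in> topspace (prod_topology T T). (case z of (x, y) \<Rightarrow> x \<otimes>\<^bsub>G\<^esub> y) \<in> U}"
          using s by (auto simp: topspace_T intro: red_mult)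
        ultimately show "\<exists>U' V. openin T U' \<and> openin T V \<and> x \<in> U' \<and> y \<in> V \<and>
            U' \<times> V \<subseteq> {z \<in> topspace (prod_topology T T). (case z of (x, y) \<Rightarrow> x \<otimes>\<^bsub>G\<^esub> y) \<in> U}"
          using xy by (intro exI[of _ "?C x"] exI[of _ "?C y"]) (auto simp: topspace_T)
      qed
    qed (auto simp: topspace_T)
    show "continuous_map T T (\<lambda>x. inv\<^bsub>G\<^esub> x)"
      unfolding continuous_map_def
    proof (intro conjI allI impI)
      fix U assume U: "openin T U"
      show "openin T {x \<in> topspace T. inv\<^bsub>G\<^esub> x \<in> U}"
        unfolding openin_T topspace_T
      proof (intro conjI ballI)
        fix x assume x: "x \<in> {x \<in> carrier G. inv\<^bsub>G\<^esub> x \<in> U}"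
        then have "inv\<^bsub>G\<^esub> x \<in> U" by simp
        then obtain s where s: "\<And>z. z \<in> carrier G \<Longrightarrow> red s z = red s (inv\<^bsub>G\<^esub> x) \<Longrightarrow> z \<in> U"
          using U unfolding openin_T by meson
        have "inv\<^bsub>G\<^esub> y \<in> U" if "y \<in> carrier G" "red s y = red s x" for y
          using that x by (intro s red_inv) auto
        then show "\<exists>s. \<forall>y\<in>carrier G. red s y = red s x \<longrightarrow> y \<in> {x \<in> carrier G. inv\<^bsub>G\<^esub> x \<in> U}"
          by blast
      qed auto
    qed (auto simp: topspace_T)
  qed (simp_all add: topspace_T)
qed (rule compact_T)

section \<open>Congruence subgroups and isolated points\<close>

definition level :: "nat \<Rightarrow> (nat \<Rightarrow> int) set" where
  "level s = {x \<in> carrier G. red s x = red s \<one>\<^bsub>G\<^esub>}"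

lemma level_open_normal: "level s \<in> open_normal_subgroups G T"
  unfolding open_normal_subgroups_def
proof (intro CollectI conjI G.subgroup_imp_normal G.subgroupI)
  show "openin T (level s)" unfolding level_def by (rule openin_red)
qed (auto simp: level_def red_def fun_eq_iff)

text \<open>The congruence subgroups are thus cofinal among the open normal subgroups, and
  \<open>s\<close> can replace \<open>N\<close> in the neighbourhoods
  \<open>B(H, N)\<close>.\<close>

lemma open_normal_contains_level:
  assumes "N \<in> open_normal_subgroups G T"
  obtains s where "level s \<subseteq> N"
proof -
  have "\<one>\<^bsub>G\<^esub> \<in> N" "openin T N"
    using assms by (auto simp: open_normal_subgroups_def normal_def dest: subgroup.one_closed)
  then show ?thesis using that unfolding openin_T level_def by fastforce
qed

lemma closed_subgroups_iff:
  "H \<in> closed_subgroups G T \<longleftrightarrow>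
     subgroup H G \<and> (\<forall>x\<in>carrier G. (\<forall>s. \<exists>h\<in>H. red s h = red s x) \<longrightarrow> x \<in> H)"
  unfolding closed_subgroups_def closedin_T by (auto dest: subgroup.subset)

text \<open>\<open>level s\<close> is the kernel of the reduction, so multiplying by it saturates
  \<open>H\<close> along the fibres of \<open>red s\<close>.\<close>

lemma set_mult_level:
  assumes "H \<subseteq> carrier G"
  shows "H <#>\<^bsub>G\<^esub> level s = {x \<in> carrier G. red s x \<in> red s ` H}"
proof (intro equalityI subsetI)
  fix x assume "x \<in> H <#>\<^bsub>G\<^esub> level s"
  then obtain h n where x: "x = h \<otimes>\<^bsub>G\<^esub> n" "h \<in> H" "n \<in> level s" by (auto simp: set_mult_def)
  then have "red s x = red s (h \<otimes>\<^bsub>G\<^esub> \<one>\<^bsub>G\<^esub>)" by (auto intro: red_mult simp: level_def)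
  then show "x \<in> {x \<in> carrier G. red s x \<in> red s ` H}" using x assms by (auto simp: level_def)
next
  fix x assume "x \<in> {x \<in> carrier G. red s x \<in> red s ` H}"
  then obtain h where h: "x \<in> carrier G" "h \<in> H" "red s x = red s h" by auto
  then have hc: "h \<in> carrier G" using assms by auto
  have "red s (inv\<^bsub>G\<^esub> h \<otimes>\<^bsub>G\<^esub> x) = red s (inv\<^bsub>G\<^esub> h \<otimes>\<^bsub>G\<^esub> h)" using h by (intro red_mult) auto
  then have "inv\<^bsub>G\<^esub> h \<otimes>\<^bsub>G\<^esub> x \<in> level s" using hc h by (auto simp: level_def)
  moreover have "x = h \<otimes>\<^bsub>G\<^esub> (inv\<^bsub>G\<^esub> h \<otimes>\<^bsub>G\<^esub> x)" using hc h by (simp flip: G.m_assoc)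
  ultimately show "x \<in> H <#>\<^bsub>G\<^esub> level s" using h by (auto simp: set_mult_def)
qed

lemma set_mult_level_eq_iff:
  assumes "H \<subseteq> carrier G" "K \<subseteq> carrier G"
  shows "K <#>\<^bsub>G\<^esub> level s = H <#>\<^bsub>G\<^esub> level s \<longleftrightarrow> red s ` K = red s ` H"
  unfolding set_mult_level[OF assms(1)] set_mult_level[OF assms(2)] using assms by blast

text \<open>Shrinking \<open>N\<close> to a congruence subgroup shrinks the neighbourhood of
  \<open>H\<close>, and \<open>K\<close> and \<open>H\<close> have the same product with
  \<open>level s\<close> exactly if their reductions agree. From here on isolation is a statement
  about reductions only.\<close>

lemma isolated_iff:
  assumes "A \<subseteq> closed_subgroups G T"
  shows "H \<in> isolated_points (subgroup_space G T) A \<longleftrightarrow>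
     H \<in> A \<and> (\<exists>s. \<forall>K\<in>A. red s ` K = red s ` H \<longrightarrow> K = H)"
proof -
  have sub: "H \<subseteq> carrier G" if "H \<in> closed_subgroups G T" for H
    using that by (auto simp: closed_subgroups_iff dest: subgroup.subset)
  have nb: "K \<in> subgroup_nbhd G T H (level s) \<longleftrightarrow> red s ` K = red s ` H" if "H \<in> A" "K \<in> A" for H K s
    using that assms sub set_mult_level_eq_iff[of H K s] by (auto simp: subgroup_nbhd_def)
  show ?thesis
  proof
    assume L: "H \<in> isolated_points (subgroup_space G T) A"
    then have H: "H \<in> A" by (simp add: isolated_points_def)
    from L obtain U where U: "openin (subgroup_space G T) U" "{H} = U \<inter> A"
      unfolding isolated_points_def openin_subtopology by auto
    then obtain N where N: "N \<in> open_normal_subgroups G T" "subgroup_nbhd G T H N \<subseteq> U"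
      unfolding openin_subgroup_space[OF G.group_axioms topspace_T] by blast
    from N(1) obtain s where "level s \<subseteq> N" by (rule open_normal_contains_level)
    then have s: "subgroup_nbhd G T H (level s) \<subseteq> U"
      using subgroup_nbhd_mono[OF G.group_axioms topspace_T level_open_normal N(1)] H assms N(2) by blast
    then show "H \<in> A \<and> (\<exists>s. \<forall>K\<in>A. red s ` K = red s ` H \<longrightarrow> K = H)"
      using H nb U(2) by blast
  next
    assume R: "H \<in> A \<and> (\<exists>s. \<forall>K\<in>A. red s ` K = red s ` H \<longrightarrow> K = H)"
    then obtain s where s: "\<And>K. K \<in> A \<Longrightarrow> red s ` K = red s ` H \<Longrightarrow> K = H" by blast
    have "openin (subgroup_space G T) (subgroup_nbhd G T H (level s))"
      unfolding subgroup_space_def using R assms level_open_normal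
      by (intro topology_generated_by_Basis) blast
    moreover have "{H} = subgroup_nbhd G T H (level s) \<inter> A"
    proof (intro equalityI subsetI)
      fix K assume "K \<in> subgroup_nbhd G T H (level s) \<inter> A"
      then show "K \<in> {H}" using nb[of H K s] R s[of K] by simp
    next
      fix K assume "K \<in> {H}"
      then show "K \<in> subgroup_nbhd G T H (level s) \<inter> A" using nb[of H H s] R by simp
    qed
    ultimately show "H \<in> isolated_points (subgroup_space G T) A"
      using R unfolding isolated_points_def openin_subtopology mem_Collect_eq by (intro conjI exI) auto
  qed
qed

end

section \<open>Closed subgroups\<close>

text \<open>Divisors of \<open>p ^ s\<close> are powers \<open>p ^ j\<close> up to sign, and
  \<open>v \<le> j\<close> would make \<open>p ^ v\<close> divide \<open>a\<close>. This yields the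
  solvability of a linear congruence in \<open>cyclic_open\<close>.\<close>

lemma gcd_prime_power_dvd:
  fixes p a :: int
  assumes p: "prime p" and "\<not> p ^ v dvd a"
  shows "gcd a (p ^ s) dvd p ^ v"
proof -
  obtain j where j: "gcd a (p ^ s) = p ^ j"
    using divides_primepow[OF p, of "gcd a (p ^ s)" s] p
    by (metis gcd_dvd2 normalize_gcd normalize_power normalize_prime)
  have "\<not> v \<le> j"
    using assms(2) j by (metis dvd_trans gcd_dvd1 le_imp_power_dvd)
  then show ?thesis by (simp add: j le_imp_power_dvd)
qed

context adic
begin

lemma coord_int_pow [simp]:
  assumes "x \<in> carrier G"
  shows "coord (x [^]\<^bsub>G\<^esub> (t::int)) c r = (t * coord x c r) mod q c r"
proof (cases "t < 0")
  case True
  then have "coord (x [^]\<^bsub>G\<^esub> t) c r = coord (inv\<^bsub>G\<^esub> (x [^]\<^bsub>G\<^esub> nat (- t))) c r"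
    by (subst int_pow_def2) simp
  also have "\<dots> = (- ((int (nat (- t)) * coord x c r) mod q c r)) mod q c r"
    by (subst coord_inv) (use assms in \<open>simp_all only: coord_pow G.nat_pow_closed\<close>)
  also have "\<dots> = (t * coord x c r) mod q c r"
    using True by (subst mod_minus_eq) simp
  finally show ?thesis .
next
  case False
  then have "coord (x [^]\<^bsub>G\<^esub> t) c r = coord (x [^]\<^bsub>G\<^esub> nat t) c r"
    by (subst int_pow_def2) simp
  also have "\<dots> = (int (nat t) * coord x c r) mod q c r" by (rule coord_pow[OF assms])
  finally show ?thesis using False by simp
qed

section \<open>Closed subgroups: limits, preimages, intersections\<close>

lemma closed_subgroup_subset: "H \<in> closed_subgroups G T \<Longrightarrow> x \<in> H \<Longrightarrow> x \<in> carrier G"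
  by (auto simp: closed_subgroups_iff dest: subgroup.subset)

lemma closed_subgroup_limit:
  "\<lbrakk>H \<in> closed_subgroups G T; x \<in> carrier G; \<And>s. \<exists>h\<in>H. red s h = red s x\<rbrakk> \<Longrightarrow> x \<in> H"
  by (auto simp: closed_subgroups_iff)

lemma closed_subgroup_mult: "H \<in> closed_subgroups G T \<Longrightarrow> x \<in> H \<Longrightarrow> y \<in> H \<Longrightarrow> x \<otimes>\<^bsub>G\<^esub> y \<in> H"
  by (auto simp: closed_subgroups_iff subgroup.m_closed)

lemma closed_subgroup_inv: "H \<in> closed_subgroups G T \<Longrightarrow> x \<in> H \<Longrightarrow> inv\<^bsub>G\<^esub> x \<in> H"
  by (auto simp: closed_subgroups_iff subgroup.m_inv_closed)

lemma closed_subgroup_one: "H \<in> closed_subgroups G T \<Longrightarrow> \<one>\<^bsub>G\<^esub> \<in> H"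
  by (auto simp: closed_subgroups_iff subgroup.one_closed)

lemma closed_subgroup_pow: "H \<in> closed_subgroups G T \<Longrightarrow> x \<in> H \<Longrightarrow> x [^]\<^bsub>G\<^esub> (t::int) \<in> H"
  by (auto simp: closed_subgroups_iff G.subgroup_int_pow_closed)

text \<open>Respecting every \<open>red s\<close> is a uniform form of continuity of
  \<open>f\<close>: approximations of \<open>x\<close> are mapped to equally good approximations of
  \<open>f x\<close>.\<close>

lemma closed_subgroups_vimage:
  assumes H: "H \<in> closed_subgroups G T"
    and f: "f \<in> hom G G" "\<And>s x y. red s x = red s y \<Longrightarrow> red s (f x) = red s (f y)"
  shows "{x \<in> carrier G. f x \<in> H} \<in> closed_subgroups G T"
  unfolding closed_subgroups_iff
proof (intro conjI ballI impI)
  interpret f: group_hom G G f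
    using f(1) by unfold_locales
  show "subgroup {x \<in> carrier G. f x \<in> H} G"
    by (rule G.subgroupI)
      (use H f.hom_one in \<open>auto intro: closed_subgroup_mult closed_subgroup_inv closed_subgroup_one
        intro!: exI[of _ "\<one>\<^bsub>G\<^esub>"]\<close>)
  fix x assume x: "x \<in> carrier G" "\<forall>s. \<exists>h\<in>{x \<in> carrier G. f x \<in> H}. red s h = red s x"
  have "\<exists>h\<in>H. red s h = red s (f x)" for s
    using x(2) f(2) by (metis (mono_tags, lifting) mem_Collect_eq)
  then have "f x \<in> H" using closed_subgroup_limit[OF H] x(1) by simp
  then show "x \<in> {x \<in> carrier G. f x \<in> H}" using x(1) by simp
qed

lemma closed_subgroups_Int:
  assumes "H \<in> closed_subgroups G T" "K \<in> closed_subgroups G T"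
  shows "H \<inter> K \<in> closed_subgroups G T"
  using assms G.subgroups_Inter_pair unfolding closed_subgroups_iff by blast

lemma closed_subgroup_coord_zero: "{x \<in> carrier G. coord x c r = 0} \<in> closed_subgroups G T"
  unfolding closed_subgroups_iff
proof (intro conjI ballI impI)
  show "subgroup {x \<in> carrier G. coord x c r = 0} G"
    by (rule G.subgroupI) (auto intro: exI[of _ "\<one>\<^bsub>G\<^esub>"])
  fix x assume x: "x \<in> carrier G" "\<forall>s. \<exists>h\<in>{x \<in> carrier G. coord x c r = 0}. red s h = red s x"
  then obtain h where "coord h c r = 0" "red r h = red r x" by blast
  then show "x \<in> {x \<in> carrier G. coord x c r = 0}" using x(1) by (auto simp: red_def fun_eq_iff)
qed

lemma closed_subgroup_trivial: "{\<one>\<^bsub>G\<^esub>} \<in> closed_subgroups G T"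
  unfolding closed_subgroups_iff
proof (intro conjI ballI impI)
  show "subgroup {\<one>\<^bsub>G\<^esub>} G" by (rule G.triv_subgroup)
  fix x assume x: "\<forall>s. \<exists>h\<in>{\<one>\<^bsub>G\<^esub>}. red s h = red s x"
  have "x = \<one>\<^bsub>G\<^esub>"
  proof (rule coord_eqI)
    fix c r show "coord x c r = coord \<one>\<^bsub>G\<^esub> c r" using x by (auto simp: red_def fun_eq_iff)
  qed
  then show "x \<in> {\<one>\<^bsub>G\<^esub>}" by simp
qed

section \<open>Projections to coordinates and procyclic subgroups\<close>

definition res :: "nat set \<Rightarrow> (nat \<Rightarrow> int) \<Rightarrow> nat \<Rightarrow> int" where
  "res C x = of_coords (\<lambda>c r. if c \<in> C then coord x c r else 0)"

lemma coord_res [simp]: "coord (res C x) c r = (if c \<in> C then coord x c r else 0)"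
  by (simp add: res_def)

lemma res_closed [simp]: "x \<in> carrier G \<Longrightarrow> res C x \<in> carrier G"
  by (rule carrierI[of _ "\<lambda>c r. if c \<in> C then coord x c r else 0"]) (auto intro: coord_Suc_cong)

lemma res_mult: "res C (x \<otimes>\<^bsub>G\<^esub> y) = res C x \<otimes>\<^bsub>G\<^esub> res C y"
  by (rule coord_eqI) simp

lemma res_hom: "res C \<in> hom G G"
  by (rule homI) (simp_all add: res_mult)

lemma red_res: "red s x = red s y \<Longrightarrow> red s (res C x) = red s (res C y)"
  by (simp add: red_def fun_eq_iff)

text \<open>In coordinate \<open>c\<close>, a copy of Z_p with \<open>p = w c\<close>, the element
  \<open>h\<close> has valuation less than \<open>v\<close>, so the closed subgroup it generates
  contains all multiples of \<open>p ^ v\<close>.\<close>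

lemma cyclic_open:
  assumes H: "H \<in> closed_subgroups G T" and h: "h \<in> H" "\<And>c' r. c' \<noteq> c \<Longrightarrow> coord h c' r = 0"
    and p: "prime (w c)" and v: "coord h c v \<noteq> 0"
    and x: "x \<in> carrier G" "\<And>c' r. c' \<noteq> c \<Longrightarrow> coord x c' r = 0" "coord x c v = 0"
  shows "x \<in> H"
proof (rule closed_subgroup_limit[OF H x(1)])
  fix s
  have hc: "h \<in> carrier G" using H h closed_subgroup_subset by blast
  show "\<exists>h'\<in>H. red s h' = red s x"
  proof (cases "s \<le> v")
    case True
    then have "coord x c s = 0" using coord_mod_le[OF x(1) True, of c] x(3) by simp
    then have "coord x c' s = 0" for c' using x(2) by (cases "c' = c") auto
    then have "red s \<one>\<^bsub>G\<^esub> = red s x" by (simp add: red_def)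
    then show ?thesis using closed_subgroup_one[OF H] by blast
  next
    case False
    then have vs: "v \<le> s" by simp
    have "\<not> q c v dvd coord h c s"
      using coord_mod_le[OF hc vs, of c] v by (metis dvd_imp_mod_0)
    then have "gcd (coord h c s) (q c s) dvd q c v"
      using gcd_prime_power_dvd[of "int (w c)"] p by simp
    also have "q c v dvd coord x c s"
      using coord_mod_le[OF x(1) vs, of c] x(3) by auto
    \<comment> \<open>The gcd of the residue of \<open>h\<close> and the modulus divides the residue
      of \<open>x\<close>, so the congruence is solvable; \<open>t\<close> depends on
      \<open>s\<close>, and closedness of \<open>H\<close> supplies the limit.\<close>
    finally obtain t where t: "[coord h c s * t = coord x c s] (mod q c s)"
      using cong_solve_dvd_int by blast
    have "red s (h [^]\<^bsub>G\<^esub> t) = red s x"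
    proof -
      have "coord (h [^]\<^bsub>G\<^esub> t) c' s = coord x c' s" for c'
        using t x h(2) hc by (cases "c' = c") (simp_all add: cong_def mult.commute)
      then show ?thesis by (simp add: red_def)
    qed
    then show ?thesis using closed_subgroup_pow[OF H h(1)] by blast
  qed
qed

text \<open>For \<open>p = w c > 1\<close> this is the element \<open>p ^ r\<close> of the factor
  \<open>c\<close>, nonzero yet trivial modulo \<open>p ^ r\<close>; it witnesses that a subgroup
  vanishing in coordinate \<open>c\<close> is not open. For \<open>r = 0\<close> it is a topological
  generator of the factor.\<close>

definition prime_power_at :: "nat \<Rightarrow> nat \<Rightarrow> nat \<Rightarrow> int" where
  "prime_power_at c r = of_coords (\<lambda>c' s. if c' = c then q c r mod q c s else 0)"

lemma coord_prime_power_at [simp]: "coord (prime_power_at c r) c' s = (if c' = c then q c r mod q c s else 0)"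
  by (simp add: prime_power_at_def)

lemma prime_power_at_closed [simp]: "prime_power_at c r \<in> carrier G"
  by (rule carrierI[of _ "\<lambda>c' s. if c' = c then q c r else 0"]) auto

lemma coord_prime_power_at_nonzero: "w c > 1 \<Longrightarrow> coord (prime_power_at c r) c (Suc r) \<noteq> 0"
  by simp

text \<open>Translating coordinate \<open>c\<close> by \<open>t\<close> times coordinate \<open>c'\<close> is the transvection \<open>x + transvect c c' t x\<close>.\<close>

definition transvect :: "nat \<Rightarrow> nat \<Rightarrow> int \<Rightarrow> (nat \<Rightarrow> int) \<Rightarrow> nat \<Rightarrow> int" where
  "transvect c c' t x = of_coords (\<lambda>d r. if d = c then (t * coord x c' r) mod q c r else 0)"

lemma coord_transvect [simp]: "coord (transvect c c' t x) d r = (if d = c then (t * coord x c' r) mod q c r else 0)"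
  by (simp add: transvect_def)

lemma transvect_closed [simp]:
  assumes "x \<in> carrier G" "w c = w c'"
  shows "transvect c c' t x \<in> carrier G"
  by (rule carrierI[of _ "\<lambda>d r. if d = c then t * coord x c' r else 0"])
    (auto intro!: cong_scalar_left simp: assms(2) coord_Suc_cong[OF assms(1)])

lemma transvect_mult:
  assumes "w c = w c'"
  shows "transvect c c' t (x \<otimes>\<^bsub>G\<^esub> y) = transvect c c' t x \<otimes>\<^bsub>G\<^esub> transvect c c' t y"
  by (rule coord_eqI) (simp add: assms mod_simps algebra_simps)

lemma shear_hom:
  assumes "w c = w c'"
  shows "(\<lambda>x. x \<otimes>\<^bsub>G\<^esub> transvect c c' t x) \<in> hom G G"
  by (rule homI) (use assms in \<open>simp_all add: transvect_mult G.m_ac\<close>)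

lemma red_transvect: "red s x = red s y \<Longrightarrow> red s (transvect c c' t x) = red s (transvect c c' t y)"
  by (simp add: red_def fun_eq_iff)

text \<open>As \<open>c \<noteq> c'\<close>, the first shear leaves coordinate \<open>c'\<close>
  unchanged, so the second one adds back exactly what was subtracted.\<close>

lemma shear_inverse:
  assumes "x \<in> carrier G" "w c = w c'" "c \<noteq> c'"
  shows "(x \<otimes>\<^bsub>G\<^esub> transvect c c' (- t) x) \<otimes>\<^bsub>G\<^esub> transvect c c' t (x \<otimes>\<^bsub>G\<^esub> transvect c c' (- t) x) = x"
proof (rule coord_eqI)
  have "(a + (- b) mod n + b) mod n = a mod n" for a b n :: int
  proof -
    have "(a + (- b) mod n + b) mod n = (a + ((- b) mod n + b) mod n) mod n"
      by (simp only: mod_add_right_eq add.assoc)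
    also have "((- b) mod n + b) mod n = 0" by (simp add: mod_add_left_eq)
    finally show ?thesis by simp
  qed
  then show "coord ((x \<otimes>\<^bsub>G\<^esub> transvect c c' (- t) x) \<otimes>\<^bsub>G\<^esub> transvect c c' t (x \<otimes>\<^bsub>G\<^esub> transvect c c' (- t) x)) d r = coord x d r" for d r
    using assms coord_mod[OF assms(1), of c r] by (auto simp: mod_simps)
qed

lemma red_shear: "w c = w c' \<Longrightarrow> x \<in> carrier G \<Longrightarrow> q c s dvd t \<Longrightarrow> red s (x \<otimes>\<^bsub>G\<^esub> transvect c c' t x) = red s x"
  by (auto simp: red_def fun_eq_iff mod_simps) (metis add.right_neutral coord_mod dvd_mult2 mod_0_imp_dvd dvd_imp_mod_0 mod_add_right_eq)

end

section \<open>The order\<close>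

text \<open>Cauchy's theorem: Sylow's theorem with exponent 1 gives a subgroup of order
  \<open>p\<close>, and any of its nontrivial elements serves.\<close>

lemma cauchy_element:
  assumes "group Q" "finite (carrier Q)" and p: "prime p" "p dvd order Q"
  obtains g where "g \<in> carrier Q" "g \<noteq> \<one>\<^bsub>Q\<^esub>" "g [^]\<^bsub>Q\<^esub> p = \<one>\<^bsub>Q\<^esub>"
proof -
  interpret Q: group Q by fact
  obtain n where "order Q = p ^ 1 * n" using p(2) by auto
  then obtain S where S: "subgroup S Q" "card S = p"
    using sylow_thm[OF p(1) assms(1) _ assms(2)] by fastforce
  have "1 < card S" using S(2) p(1) prime_gt_1_nat by simp
  then obtain g where g: "g \<in> S" "g \<noteq> \<one>\<^bsub>Q\<^esub>"
    by (metis card_le_Suc0_iff_eq card.infinite One_nat_def not_le not_one_less_zero)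
  interpret S: group "Q\<lparr>carrier := S\<rparr>" by (rule subgroup.subgroup_is_group[OF S(1) assms(1)])
  have "g [^]\<^bsub>Q\<lparr>carrier := S\<rparr>\<^esub> order (Q\<lparr>carrier := S\<rparr>) = \<one>\<^bsub>Q\<lparr>carrier := S\<rparr>\<^esub>"
    by (rule S.pow_order_eq_1) (use g in simp)
  then have "g [^]\<^bsub>Q\<^esub> p = \<one>\<^bsub>Q\<^esub>"
    using S(2) by (simp add: order_def flip: Q.nat_pow_consistent)
  then show ?thesis using that g subgroup.subset[OF S(1)] by blast
qed

context adic
begin

lemma finite_quotient_level: "finite (carrier (G Mod level s))"
proof -
  let ?A = "{c. w c \<noteq> 1}" and ?B = "\<Union>c\<in>{c. w c \<noteq> 1}. {0..<q c s}"
  have "red s ` carrier G \<subseteq> {f. \<forall>c. (c \<in> ?A \<longrightarrow> f c \<in> ?B) \<and> (c \<notin> ?A \<longrightarrow> f c = 0)}"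
    by (auto simp: red_def coord_trivial) (auto simp: mem_carrier)
  moreover have "finite {f. \<forall>c. (c \<in> ?A \<longrightarrow> f c \<in> ?B) \<and> (c \<notin> ?A \<longrightarrow> f c = 0)}"
    using fin by (intro finite_set_of_finite_funs) auto
  ultimately have "finite (red s ` carrier G)" by (rule finite_subset)
  moreover have "carrier (G Mod level s) \<subseteq> (\<lambda>f. {x \<in> carrier G. red s x = f}) ` (red s ` carrier G)"
  proof
    fix X assume "X \<in> carrier (G Mod level s)"
    then obtain a where a: "a \<in> carrier G" "X = level s #>\<^bsub>G\<^esub> a" by (auto simp: carrier_FactGroup)
    have "level s \<lhd> G" using level_open_normal by (simp add: open_normal_subgroups_def)
    then have "X = {a} <#>\<^bsub>G\<^esub> level s"
      using a by (simp add: normal.coset_eq l_coset_eq_set_mult)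
    then have "X = {x \<in> carrier G. red s x = red s a}" using a by (simp add: set_mult_level)
    then show "X \<in> (\<lambda>f. {x \<in> carrier G. red s x = f}) ` (red s ` carrier G)" using a by blast
  qed
  ultimately show ?thesis by (meson finite_imageI finite_subset)
qed

lemma quotient_pow:
  assumes "N \<lhd> G" "x \<in> carrier G"
  shows "(N #>\<^bsub>G\<^esub> x) [^]\<^bsub>G Mod N\<^esub> (t::nat) = N #>\<^bsub>G\<^esub> (x [^]\<^bsub>G\<^esub> t)"
  using hom_nat_pow[OF normal.r_coset_hom_Mod[OF assms(1)] assms(2) G.group_axioms
      normal.factorgroup_is_group[OF assms(1)]] by (rule sym)

text \<open>The generator of the factor \<open>c\<close> has order divisible by \<open>p ^ e\<close>
  modulo \<open>level e\<close>, so every \<open>p ^ e\<close> divides the order of a finite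
  quotient.\<close>

lemma profinite_order_eq_infinity:
  assumes p: "prime p" and c: "w c = p"
  shows "profinite_order G T p = \<infinity>"
proof -
  have "enat e \<le> profinite_order G T p" for e
  proof -
    let ?N = "level e"
    have N: "?N \<in> open_normal_subgroups G T" by (rule level_open_normal)
    then have norm: "?N \<lhd> G" by (simp add: open_normal_subgroups_def)
    interpret N: normal ?N G by fact
    interpret Q: group "G Mod ?N" by (rule N.factorgroup_is_group)
    let ?u = "prime_power_at c 0" and ?t = "order (G Mod ?N)"
    have "(?N #>\<^bsub>G\<^esub> ?u) [^]\<^bsub>G Mod ?N\<^esub> ?t = \<one>\<^bsub>G Mod ?N\<^esub>"
      by (rule Q.pow_order_eq_1) (auto simp: carrier_FactGroup)
    then have "?N #>\<^bsub>G\<^esub> (?u [^]\<^bsub>G\<^esub> ?t) = ?N" using quotient_pow[OF norm, of ?u ?t] by simp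
    then have "?u [^]\<^bsub>G\<^esub> ?t \<in> ?N" by (rule G.coset_join1) (simp_all add: N.subgroup_axioms)
    then have "red e (?u [^]\<^bsub>G\<^esub> ?t) c = red e \<one>\<^bsub>G\<^esub> c" by (simp only: level_def mem_Collect_eq)
    then have "(int ?t * (1 mod q c e)) mod q c e = 0"
      by (simp only: red_def coord_pow prime_power_at_closed coord_prime_power_at coord_one power_0 simp_thms if_True)
    then have "q c e dvd int ?t" by (simp only: mod_mult_right_eq mod_eq_0_iff_dvd mult_1_right)
    then have "int (p ^ e) dvd int ?t" by (simp only: c of_nat_power)
    then have "p ^ e dvd ?t" by (simp only: of_nat_dvd_iff)
    moreover have "?t \<noteq> 0" using finite_quotient_level[of e] Q.order_gt_0_iff_finite by simp
    ultimately have "e \<le> multiplicity p ?t" using p by (intro multiplicity_geI) auto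
    then have "enat e \<le> supernatural_of_nat ?t p" using p by (simp add: supernatural_of_nat_def)
    also have "\<dots> \<le> profinite_order G T p"
      unfolding profinite_order_def supernatural_lcm_def
      by (rule SUP_upper) (use N finite_quotient_level in blast)
    finally show ?thesis .
  qed
  then show ?thesis by (metis enat_ord_code(3) enat_ord_simps(1) not_enat_eq Suc_n_not_le_n)
qed

text \<open>Every \<open>N\<close> contains some \<open>level s\<close>, so the quotient is
  annihilated by a product of \<open>s\<close>-th powers of the \<open>w c\<close>, which is prime
  to \<open>p\<close>; by Cauchy's theorem \<open>p\<close> cannot divide its order.\<close>

lemma profinite_order_eq_0:
  assumes p: "prime p" and "\<And>c. \<not> p dvd w c"
  shows "profinite_order G T p = 0"
proof -
  have "supernatural_of_nat (order (G Mod N)) p = 0"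
    if N: "N \<in> open_normal_subgroups G T" and f: "finite (carrier (G Mod N))" for N
  proof -
    have norm: "N \<lhd> G" using N by (simp add: open_normal_subgroups_def)
    interpret N: normal N G by fact
    interpret Q: group "G Mod N" by (rule N.factorgroup_is_group)
    obtain s where s: "level s \<subseteq> N" using N by (rule open_normal_contains_level)
    define M where "M = (\<Prod>c\<in>{c. w c \<noteq> 1}. w c) ^ s"
    have "\<not> p dvd M"
      unfolding M_def using assms prime_dvd_power[OF p] prime_dvd_prod_iff[OF fin p, of w] by blast
    have "\<not> p dvd order (G Mod N)"
    proof
      assume "p dvd order (G Mod N)"
      then obtain g where g: "g \<in> carrier (G Mod N)" "g \<noteq> \<one>\<^bsub>G Mod N\<^esub>" "g [^]\<^bsub>G Mod N\<^esub> p = \<one>\<^bsub>G Mod N\<^esub>"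
        using cauchy_element[OF Q.group_axioms f p] by blast
      then obtain x where x: "x \<in> carrier G" "g = N #>\<^bsub>G\<^esub> x" by (auto simp: carrier_FactGroup)
      have "coord (x [^]\<^bsub>G\<^esub> M) c s = 0" for c
      proof (cases "w c = 1")
        case True
        then show ?thesis using x coord_trivial by simp
      next
        case False
        then have "w c dvd (\<Prod>c\<in>{c. w c \<noteq> 1}. w c)" using fin by (intro dvd_prodI) auto
        then have "w c ^ s dvd M" unfolding M_def by (rule dvd_power_same)
        then have "q c s dvd int M" by (metis of_nat_dvd_iff of_nat_power)
        then show ?thesis using x by simp
      qed
      then have "x [^]\<^bsub>G\<^esub> M \<in> level s" using x by (simp add: level_def red_def)
      then have "g [^]\<^bsub>G Mod N\<^esub> M = \<one>\<^bsub>G Mod N\<^esub>"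
        using s x quotient_pow[OF norm x(1)] G.coset_join2[OF _ N.subgroup_axioms] by auto
      then have "Q.ord g dvd M" "Q.ord g dvd p" using g Q.pow_eq_id by auto
      then have "Q.ord g = 1" using p \<open>\<not> p dvd M\<close> by (metis prime_nat_iff)
      then show False using g Q.ord_eq_1 by blast
    qed
    then show ?thesis by (simp add: supernatural_of_nat_def not_dvd_imp_multiplicity_0 zero_enat_def)
  qed
  then have "profinite_order G T p \<le> 0"
    unfolding profinite_order_def supernatural_lcm_def by (intro SUP_least) auto
  then show ?thesis by simp
qed

end

section \<open>The scattered height\<close>

text \<open>
  Coordinates \<open>2 * i\<close> and \<open>2 * i + 1\<close> form the \<open>P i\<close>-component, the second one being trivial for \<open>i < m\<close>.
\<close>

definition weight :: "(nat \<Rightarrow> nat) \<Rightarrow> nat \<Rightarrow> nat \<Rightarrow> nat \<Rightarrow> nat" where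
  "weight P m k c = (if c div 2 < k \<and> (even c \<or> m \<le> c div 2) then P (c div 2) else 1)"

text \<open>\<open>k\<close> counts the primes and \<open>m\<close> those among them with a single
  factor Z_p; the height will be \<open>Suc m\<close>. Distinctness of the primes splits closed
  subgroups into components.\<close>

locale padic_product =
  fixes P :: "nat \<Rightarrow> nat" and m k :: nat
  assumes prime_P: "\<And>i. prime (P i)" and inj_P: "inj P" and m_le: "m \<le> k"
begin

abbreviation w where "w \<equiv> weight P m k"

sublocale adic w
proof
  show "0 < w c" for c using prime_P prime_gt_0_nat by (simp add: weight_def)
  have "{c. w c \<noteq> 1} \<subseteq> {..<2 * k}" by (auto simp: weight_def split: if_splits)
  then show "finite {c. w c \<noteq> 1}" using finite_subset by blast
qed

section \<open>Components of closed subgroups and lifting from finite level\<close>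

definition block :: "nat \<Rightarrow> nat set" where "block i = {c. c div 2 = i}"

lemma w_block: "c \<in> block i \<Longrightarrow> w c = P i \<or> w c = 1"
  by (auto simp: block_def weight_def)

text \<open>Chinese remainder theorem: some integer is 1 modulo \<open>P i ^ s\<close> and 0 modulo
  the \<open>s\<close>-th powers of the other primes, and this power of \<open>x\<close> agrees with
  component \<open>i\<close> of \<open>x\<close> at level \<open>s\<close>.\<close>

lemma closed_subgroup_res:
  assumes H: "H \<in> closed_subgroups G T" and x: "x \<in> H" and i: "i < k"
  shows "res (block i) x \<in> H"
proof (rule closed_subgroup_limit[OF H])
  have xc: "x \<in> carrier G" using H x closed_subgroup_subset by blast
  then show "res (block i) x \<in> carrier G" by simp
  fix s
  define Q where "Q = (\<Prod>l\<in>{..<k} - {i}. int (P l)) ^ s"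
  have "coprime Q (int (P i) ^ s)"
    unfolding Q_def
  proof (intro coprime_power_left_iff[THEN iffD2] coprime_power_right_iff[THEN iffD2] disjI1 prod_coprime_left)
    fix l assume "l \<in> {..<k} - {i}"
    then have "P l \<noteq> P i" using inj_P by (auto dest: injD)
    then show "coprime (int (P l)) (int (P i))"
      using prime_P by (simp add: primes_coprime)
  qed
  then obtain u where u: "[Q * u = 1] (mod int (P i) ^ s)"
    using cong_solve_coprime_int by blast
  have "coord (x [^]\<^bsub>G\<^esub> (Q * u)) c s = coord (res (block i) x) c s" for c
  proof -
    have coord_pow': "coord (x [^]\<^bsub>G\<^esub> (Q * u)) c s = (Q * u * coord x c s) mod q c s"
      using xc by simp
    consider "w c = 1" | "w c = P i" "c \<in> block i" | l where "w c = P l" "l < k" "l \<noteq> i" "c \<notin> block i"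
    proof (cases "w c = 1")
      case False
      then have "c div 2 < k" "w c = P (c div 2)" by (auto simp: weight_def split: if_splits)
      then show ?thesis using that by (cases "c div 2 = i") (auto simp: block_def)
    qed
    then show ?thesis
    proof cases
      case 1
      then show ?thesis using xc coord_trivial[of _ c s] by simp
    next
      case 2
      have "[Q * u * coord x c s = 1 * coord x c s] (mod q c s)"
        using u 2 by (intro cong_scalar_right) simp
      then show ?thesis unfolding coord_pow' using 2 coord_mod[OF xc, of c s] by (simp add: cong_def)
    next
      case 3
      have "int (P l) dvd (\<Prod>l\<in>{..<k} - {i}. int (P l))"
        using 3 by (intro dvd_prodI) auto
      then have "q c s dvd Q" unfolding Q_def using 3 by (simp add: dvd_power_same)
      then show ?thesis unfolding coord_pow' using 3 by simp
    qed
  qed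
  then show "\<exists>h\<in>H. red s h = red s (res (block i) x)"
    using closed_subgroup_pow[OF H x] unfolding red_def by blast
qed

text \<open>The components are added up one block at a time; coordinates outside the first
  \<open>k\<close> blocks are trivial.\<close>

lemma mem_of_res_block_mem:
  assumes H: "H \<in> closed_subgroups G T" and x: "x \<in> carrier G"
    and "\<And>i. i < k \<Longrightarrow> res (block i) x \<in> H"
  shows "x \<in> H"
proof -
  have "res {c. c div 2 < j} x \<in> H" if "j \<le> k" for j
    using that
  proof (induction j)
    case 0
    have "res {c. c div 2 < 0} x = \<one>\<^bsub>G\<^esub>" by (rule coord_eqI) simp
    then show ?case using closed_subgroup_one[OF H] by simp
  next
    case (Suc j)
    have "res {c. c div 2 < Suc j} x = res {c. c div 2 < j} x \<otimes>\<^bsub>G\<^esub> res (block j) x"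
      by (rule coord_eqI) (use x in \<open>auto simp: block_def less_Suc_eq\<close>)
    then show ?case using Suc assms(3) closed_subgroup_mult[OF H] by simp
  qed
  moreover have "res {c. c div 2 < k} x = x"
    by (rule coord_eqI) (use x coord_trivial in \<open>auto simp: weight_def\<close>)
  ultimately show ?thesis by (metis order_refl)
qed

text \<open>The multiples of \<open>P i ^ r\<close> in component \<open>i\<close>. These subgroups
  are a neighbourhood base of the identity there, so containing one of them means that the component
  is open.\<close>

definition block_nbhd :: "nat \<Rightarrow> nat \<Rightarrow> (nat \<Rightarrow> int) set" where
  "block_nbhd i r = {x \<in> carrier G. (\<forall>c s. c \<notin> block i \<longrightarrow> coord x c s = 0) \<and> (\<forall>c. coord x c r = 0)}"

lemma block_nbhd_mult: "x \<in> block_nbhd i r \<Longrightarrow> y \<in> block_nbhd i r \<Longrightarrow> x \<otimes>\<^bsub>G\<^esub> y \<in> block_nbhd i r"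
  by (auto simp: block_nbhd_def)

lemma block_nbhd_pow: "x \<in> block_nbhd i r \<Longrightarrow> x [^]\<^bsub>G\<^esub> (t::int) \<in> block_nbhd i r"
  by (auto simp: block_nbhd_def)

lemma block_nbhd_antimono: "r \<le> s \<Longrightarrow> block_nbhd i s \<subseteq> block_nbhd i r"
  unfolding block_nbhd_def using coord_mod_le by force

lemma res_diff_block_nbhd:
  assumes "x \<in> carrier G" "y \<in> carrier G" "red s x = red s y"
  shows "res (block i) (x \<otimes>\<^bsub>G\<^esub> inv\<^bsub>G\<^esub> y) \<in> block_nbhd i s"
  using assms by (auto simp: block_nbhd_def red_def fun_eq_iff mod_simps)

text \<open>\<open>x\<close> and \<open>h\<close> agree at level \<open>s\<close>, so their
  components differ by an element of \<open>block_nbhd i s\<close>, which lies in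
  \<open>H\<close>.\<close>

lemma res_mem_of_red_eq:
  assumes H: "H \<in> closed_subgroups G T" and L: "block_nbhd i s \<subseteq> H" and i: "i < k"
    and x: "x \<in> carrier G" and h: "h \<in> H" "red s x = red s h"
  shows "res (block i) x \<in> H"
proof -
  have hc: "h \<in> carrier G" using H h closed_subgroup_subset by blast
  have "x = (x \<otimes>\<^bsub>G\<^esub> inv\<^bsub>G\<^esub> h) \<otimes>\<^bsub>G\<^esub> h" using x hc by (simp add: G.m_assoc)
  then have "res (block i) x = res (block i) (x \<otimes>\<^bsub>G\<^esub> inv\<^bsub>G\<^esub> h) \<otimes>\<^bsub>G\<^esub> res (block i) h"
    by (metis res_mult)
  then show ?thesis
    using res_diff_block_nbhd[OF x hc h(2)] L closed_subgroup_res[OF H h(1) i] closed_subgroup_mult[OF H] by auto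
qed

text \<open>As in Z_p, the elements vanishing modulo \<open>p ^ (R + a)\<close> are
  \<open>p ^ a\<close> times those vanishing modulo \<open>p ^ R\<close>.\<close>

lemma block_nbhd_divide:
  assumes u: "u \<in> block_nbhd i (R + a)"
  obtains z where "z \<in> block_nbhd i R" "u = z [^]\<^bsub>G\<^esub> (int (P i) ^ a)"
proof -
  have uc: "u \<in> carrier G" using u by (simp add: block_nbhd_def)
  define p where "p = int (P i)"
  have p0: "p > 0" using prime_P prime_gt_0_nat by (simp add: p_def)
  \<comment> \<open>Division by \<open>p ^ a\<close> costs \<open>a\<close> digits, so the residue
    modulo \<open>p ^ r\<close> is read off from level \<open>r + a\<close>.\<close>
  define f where "f = (\<lambda>c r. if c \<in> block i \<and> w c \<noteq> 1 then coord u c (r + a) div p ^ a else 0)"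
  have u0: "coord u c (R + a) = 0" for c using u by (simp add: block_nbhd_def)
  have dv: "p ^ a dvd coord u c (r + a)" if "w c = P i" for c r
  proof -
    have "coord u c a = 0" using coord_mod_le[OF uc, of a "R + a" c] u0 by simp
    moreover have "coord u c (r + a) mod q c a = coord u c a" by (rule coord_mod_le[OF uc]) simp
    ultimately show ?thesis using that by (simp add: p_def mod_eq_0_iff_dvd)
  qed
  \<comment> \<open>Compatibility of the quotients; the case \<open>s = r\<close> says that they are
    already reduced modulo \<open>p ^ r\<close>.\<close>
  have shift: "(coord u c (s + a) div p ^ a) mod p ^ r = coord u c (r + a) div p ^ a"
    if "w c = P i" "r \<le> s" for c r s
  proof -
    have "coord u c (r + a) = coord u c (s + a) mod (p ^ a * p ^ r)"
      using coord_mod_le[OF uc, of "r + a" "s + a" c] that by (simp add: p_def power_add mult.commute)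
    also have "\<dots> = p ^ a * (coord u c (s + a) div p ^ a mod p ^ r) + coord u c (s + a) mod p ^ a"
      by (rule zmod_zmult2_eq) (use p0 in simp)
    also have "coord u c (s + a) mod p ^ a = 0" using dv that by simp
    finally show ?thesis using p0 by simp
  qed
  define z where "z = of_coords f"
  have zc: "z \<in> carrier G"
  proof (rule carrierI[of _ f])
    fix c r
    consider "f c = (\<lambda>_. 0)" | "w c = P i" "f c = (\<lambda>r. coord u c (r + a) div p ^ a)"
      using w_block[of c i] by (cases "c \<in> block i \<and> w c \<noteq> 1") (auto simp: f_def)
    then show "coord z c r = f c r mod q c r" "[f c (Suc r) = f c r] (mod q c r)"
      using shift[of c r r] shift[of c r "Suc r"] by (cases; simp add: z_def p_def cong_def)+
  qed
  have "z \<in> block_nbhd i R" using zc u0 by (auto simp: block_nbhd_def z_def f_def)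
  moreover have "u = z [^]\<^bsub>G\<^esub> (int (P i) ^ a)"
  proof (rule coord_eqI)
    fix c r
    show "coord u c r = coord (z [^]\<^bsub>G\<^esub> (int (P i) ^ a)) c r"
    proof (cases "c \<in> block i \<and> w c \<noteq> 1")
      case True
      then have c: "w c = P i" using w_block by blast
      have "coord (z [^]\<^bsub>G\<^esub> (int (P i) ^ a)) c r = (p ^ a * (coord u c (r + a) div p ^ a)) mod q c r"
        using zc True by (simp add: z_def f_def p_def)
      also have "\<dots> = coord u c (r + a) mod q c r" using dv[OF c] by simp
      also have "\<dots> = coord u c r" by (rule coord_mod_le[OF uc]) simp
      finally show ?thesis by simp
    next
      case False
      then have "coord u c r = 0" using u coord_trivial[OF uc] by (auto simp: block_nbhd_def)
      then show ?thesis using zc False by (simp add: z_def f_def)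
    qed
  qed
  ultimately show ?thesis using that by blast
qed

text \<open>Nakayama's lemma by successive approximation.\<close>

lemma block_nbhd_subset_of_red:
  assumes H: "H \<in> closed_subgroups G T" and K: "K \<in> closed_subgroups G T" and L: "block_nbhd i R \<subseteq> H"
    and HK: "red (Suc R) ` H \<subseteq> red (Suc R) ` K" and i: "i < k"
  shows "block_nbhd i R \<subseteq> K"
proof -
  have base: "\<exists>y\<in>K \<inter> block_nbhd i R. red (Suc R) y = red (Suc R) x" if x: "x \<in> block_nbhd i R" for x
  proof -
    have "x \<in> H" using x L by blast
    then obtain y where y: "y \<in> K" "red (Suc R) y = red (Suc R) x" using HK by (metis image_iff subsetD)
    have yc: "y \<in> carrier G" and xc: "x \<in> carrier G" using K y closed_subgroup_subset x by (auto simp: block_nbhd_def)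
    have "red R y = red R x" using red_mono[OF yc xc _ y(2)] by simp
    then have "res (block i) y \<in> block_nbhd i R" using yc x by (auto simp: block_nbhd_def red_def fun_eq_iff)
    moreover have "red (Suc R) (res (block i) y) = red (Suc R) x"
      using y(2) x by (auto simp: block_nbhd_def red_def fun_eq_iff)
    ultimately show ?thesis using closed_subgroup_res[OF K y(1) i] by blast
  qed
  \<comment> \<open>The error left at stage \<open>a\<close> is \<open>P i ^ Suc a\<close> times
    some \<open>z\<close> in \<open>block_nbhd i R\<close>; correcting by the same multiple of a
    \<open>z'\<close> in \<open>K\<close> that agrees with \<open>z\<close> at level
    \<open>Suc R\<close> gains one more level.\<close>
  have approx: "\<exists>y\<in>K \<inter> block_nbhd i R. red (Suc R + a) y = red (Suc R + a) x" if x: "x \<in> block_nbhd i R" for x a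
  proof (induction a)
    case 0
    then show ?case using base[OF x] by simp
  next
    case (Suc a)
    then obtain y where y: "y \<in> K" "y \<in> block_nbhd i R" "red (Suc R + a) y = red (Suc R + a) x" by blast
    have yc: "y \<in> carrier G" and xc: "x \<in> carrier G" using y x by (auto simp: block_nbhd_def)
    have "x \<otimes>\<^bsub>G\<^esub> inv\<^bsub>G\<^esub> y \<in> block_nbhd i (R + Suc a)"
      using x y yc xc by (auto simp: block_nbhd_def red_def fun_eq_iff mod_simps)
    then obtain z where z: "z \<in> block_nbhd i R" "x \<otimes>\<^bsub>G\<^esub> inv\<^bsub>G\<^esub> y = z [^]\<^bsub>G\<^esub> (int (P i) ^ Suc a)"
      by (rule block_nbhd_divide)
    obtain z' where z': "z' \<in> K" "z' \<in> block_nbhd i R" "red (Suc R) z' = red (Suc R) z"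
      using base[OF z(1)] by blast
    have zc: "z \<in> carrier G" "z' \<in> carrier G" using z z' by (auto simp: block_nbhd_def)
    let ?t = "int (P i) ^ Suc a"
    have "coord (z' [^]\<^bsub>G\<^esub> ?t) c (Suc R + Suc a) = coord (z [^]\<^bsub>G\<^esub> ?t) c (Suc R + Suc a)" for c
    proof (cases "c \<in> block i \<and> w c \<noteq> 1")
      case True
      then have c: "w c = P i" using w_block by blast
      let ?s = "Suc R + Suc a"
      have "coord z' c ?s mod q c (Suc R) = coord z c ?s mod q c (Suc R)"
        using z'(3) coord_mod_le[of _ "Suc R" ?s c] zc by (simp add: red_def fun_eq_iff)
      then have "q c (Suc R) dvd coord z' c ?s - coord z c ?s" by (simp add: mod_eq_dvd_iff)
      then have "?t * q c (Suc R) dvd ?t * (coord z' c ?s - coord z c ?s)" by (rule mult_dvd_mono[OF dvd_refl])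
      moreover have "?t * q c (Suc R) = q c ?s" by (simp only: c power_add mult.commute)
      ultimately have "(?t * coord z' c ?s) mod q c ?s = (?t * coord z c ?s) mod q c ?s"
        by (simp only: mod_eq_dvd_iff right_diff_distrib)
      then show ?thesis by (simp only: coord_int_pow zc)
    next
      case False
      then have "coord z c s = 0" "coord z' c s = 0" for s
        using z z' zc coord_trivial by (auto simp: block_nbhd_def)
      then show ?thesis using zc by simp
    qed
    then have "red (Suc R + Suc a) (z' [^]\<^bsub>G\<^esub> ?t) = red (Suc R + Suc a) (z [^]\<^bsub>G\<^esub> ?t)"
      unfolding red_def by (rule ext)
    then have "red (Suc R + Suc a) (z' [^]\<^bsub>G\<^esub> ?t \<otimes>\<^bsub>G\<^esub> y) = red (Suc R + Suc a) (z [^]\<^bsub>G\<^esub> ?t \<otimes>\<^bsub>G\<^esub> y)"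
      by (rule red_mult) (rule refl)
    also have "z [^]\<^bsub>G\<^esub> ?t \<otimes>\<^bsub>G\<^esub> y = x"
      unfolding z(2)[symmetric] using xc yc by (simp add: G.m_assoc)
    finally have "red (Suc R + Suc a) (z' [^]\<^bsub>G\<^esub> ?t \<otimes>\<^bsub>G\<^esub> y) = red (Suc R + Suc a) x" .
    moreover have "z' [^]\<^bsub>G\<^esub> ?t \<otimes>\<^bsub>G\<^esub> y \<in> K \<inter> block_nbhd i R"
      using z' y K by (auto intro!: block_nbhd_mult block_nbhd_pow closed_subgroup_mult closed_subgroup_pow simp del: power_Suc)
    ultimately show ?case by blast
  qed
  show ?thesis
  proof
    fix x assume x: "x \<in> block_nbhd i R"
    then have xc: "x \<in> carrier G" by (simp add: block_nbhd_def)
    show "x \<in> K"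
    proof (rule closed_subgroup_limit[OF K xc])
      fix s
      obtain y where y: "y \<in> K" "red (Suc R + s) y = red (Suc R + s) x" using approx[OF x] by blast
      then have "red s y = red s x"
        using red_mono[OF closed_subgroup_subset[OF K y(1)] xc _ y(2), of s] by simp
      then show "\<exists>h\<in>K. red s h = red s x" using y(1) by blast
    qed
  qed
qed

section \<open>Open components, trivial components and the candidate derivatives\<close>

lemma block_iff: "c \<in> block i \<longleftrightarrow> c = 2 * i \<or> c = Suc (2 * i)"
  unfolding block_def by auto

lemma w_even: "i < k \<Longrightarrow> w (2 * i) = P i"
  by (simp add: weight_def)

lemma w_odd: "m \<le> i \<Longrightarrow> i < k \<Longrightarrow> w (Suc (2 * i)) = P i"
  by (simp add: weight_def)

lemma w_odd_small: "i < m \<Longrightarrow> w (Suc (2 * i)) = 1"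
  by (simp add: weight_def)

lemma P_gt_1: "P i > 1"
  using prime_P prime_gt_1_nat by blast

text \<open>For \<open>i < m\<close> coordinate \<open>2 * i\<close> is the whole component, so
  these are the trivial components in the factors Z_p.\<close>

definition zeros :: "(nat \<Rightarrow> int) set \<Rightarrow> nat set" where
  "zeros H = {i. i < m \<and> (\<forall>x\<in>H. \<forall>r. coord x (2 * i) r = 0)}"

definition open_at :: "(nat \<Rightarrow> int) set \<Rightarrow> nat \<Rightarrow> bool" where
  "open_at H i \<longleftrightarrow> (\<exists>r. block_nbhd i r \<subseteq> H)"

text \<open>The explicit form of the \<open>t\<close>-th derivative. A non-open component in some
  Z_p x Z_p keeps \<open>H\<close> in every stage, whereas each derivative uses up one trivial
  component in the factors Z_p.\<close>

definition cb_stage :: "nat \<Rightarrow> (nat \<Rightarrow> int) set set" where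
  "cb_stage t = {H \<in> closed_subgroups G T. (\<exists>i. m \<le> i \<and> i < k \<and> \<not> open_at H i) \<or> t \<le> card (zeros H)}"

lemma finite_zeros [simp]: "finite (zeros H)"
  by (simp add: zeros_def)

lemma prime_power_at_block_nbhd: "c \<in> block i \<Longrightarrow> prime_power_at c r \<in> block_nbhd i r"
  by (auto simp: block_nbhd_def)

lemma not_open_at:
  assumes "c \<in> block i" "w c > 1" "\<And>x r. x \<in> H \<Longrightarrow> coord x c r = 0"
  shows "\<not> open_at H i"
  unfolding open_at_def using prime_power_at_block_nbhd[OF assms(1)] coord_prime_power_at_nonzero[OF assms(2)] assms(3) by blast

lemma zeros_not_open_at: "i \<in> zeros H \<Longrightarrow> \<not> open_at H i"
  using m_le P_gt_1 by (intro not_open_at[of "2 * i"]) (auto simp: zeros_def block_iff w_even)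

text \<open>A nontrivial closed subgroup of Z_p is open, by \<open>cyclic_open\<close> applied to
  the component of an element that does not vanish there.\<close>

lemma not_zeros_open_at:
  assumes H: "H \<in> closed_subgroups G T" and i: "i < m" "i \<notin> zeros H"
  shows "open_at H i"
proof -
  have ik: "i < k" using i m_le by simp
  obtain x r where x: "x \<in> H" "coord x (2 * i) r \<noteq> 0" using i by (auto simp: zeros_def)
  have xc: "x \<in> carrier G" using H x closed_subgroup_subset by blast
  have 0: "coord y c s = 0" if "y \<in> carrier G" "c \<in> block i" "c \<noteq> 2 * i" for y c s
    using that w_odd_small[OF i(1)] coord_trivial by (auto simp: block_iff)
  have "block_nbhd i r \<subseteq> H"
  proof
    fix y assume y: "y \<in> block_nbhd i r"
    show "y \<in> H"
    proof (rule cyclic_open[OF H closed_subgroup_res[OF H x(1) ik], of "2 * i" r])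
      show "coord (res (block i) x) c' s = 0" if "c' \<noteq> 2 * i" for c' s
        using 0[OF xc] that by simp
      show "prime (w (2 * i))" using prime_P ik by (simp add: w_even)
      show "coord (res (block i) x) (2 * i) r \<noteq> 0" using x(2) by (simp add: block_iff)
      show "y \<in> carrier G" "coord y (2 * i) r = 0" using y by (auto simp: block_nbhd_def)
      show "coord y c' s = 0" if "c' \<noteq> 2 * i" for c' s
        using y 0[of y c' s] that by (cases "c' \<in> block i") (auto simp: block_nbhd_def)
    qed
  qed
  then show ?thesis by (auto simp: open_at_def)
qed

text \<open>Fix \<open>R\<close> such that \<open>H\<close> contains \<open>block_nbhd i R\<close>
  for each of its nontrivial components. By Nakayama, so does any \<open>K\<close> with the same
  reduction at level \<open>Suc R\<close>. Membership in the stage then forces \<open>K\<close> to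
  have as many trivial components, necessarily the same ones, and the others are determined by the
  reduction.\<close>

lemma isolated_if_open_at:
  assumes H: "H \<in> closed_subgroups G T" and op: "\<And>i. m \<le> i \<Longrightarrow> i < k \<Longrightarrow> open_at H i"
  shows "\<exists>s. \<forall>K\<in>cb_stage (card (zeros H)). red s ` K = red s ` H \<longrightarrow> K = H"
proof -
  have "\<exists>r. i < k \<and> i \<notin> zeros H \<longrightarrow> block_nbhd i r \<subseteq> H" for i
    using op not_zeros_open_at[OF H] by (metis not_le open_at_def)
  then obtain r where r: "\<And>i. i < k \<Longrightarrow> i \<notin> zeros H \<Longrightarrow> block_nbhd i (r i) \<subseteq> H" by metis
  define R where "R = (\<Sum>i<k. r i)"
  have RH: "block_nbhd i R \<subseteq> H" if i: "i < k" "i \<notin> zeros H" for i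
  proof -
    have "r i \<le> R" unfolding R_def using i by (intro member_le_sum) auto
    then show ?thesis using block_nbhd_antimono r i by blast
  qed
  have "K = H" if K: "K \<in> cb_stage (card (zeros H))" and e: "red (Suc R) ` K = red (Suc R) ` H" for K
  proof -
    have Kc: "K \<in> closed_subgroups G T" using K by (simp add: cb_stage_def)
    have RK: "block_nbhd i R \<subseteq> K" if i: "i < k" "i \<notin> zeros H" for i
      using block_nbhd_subset_of_red[OF H Kc RH[OF i] _ i(1)] e by simp
    \<comment> \<open>Hence the components of \<open>K\<close> in the Z_p x Z_p are open too, and
      only the counting alternative of \<open>cb_stage\<close> is left.\<close>
    have "i \<notin> zeros H" if "m \<le> i" for i using that by (simp add: zeros_def)
    then have "card (zeros H) \<le> card (zeros K)"
      using K RK unfolding cb_stage_def open_at_def by blast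
    moreover have "zeros K \<subseteq> zeros H"
    proof
      fix i assume i: "i \<in> zeros K"
      then have "i < k" using m_le by (simp add: zeros_def)
      then show "i \<in> zeros H" using zeros_not_open_at[OF i] RK unfolding open_at_def by blast
    qed
    ultimately have z: "zeros K = zeros H" by (intro card_seteq) simp_all
    have sub: "A \<subseteq> B" if A: "A \<in> closed_subgroups G T" and B: "B \<in> closed_subgroups G T"
      and zA: "zeros A = zeros H" and RB: "\<And>i. i < k \<Longrightarrow> i \<notin> zeros H \<Longrightarrow> block_nbhd i R \<subseteq> B"
      and AB: "red (Suc R) ` A = red (Suc R) ` B" for A B
    proof
      fix x assume x: "x \<in> A"
      have xc: "x \<in> carrier G" using A x closed_subgroup_subset by blast
      show "x \<in> B"
      proof (rule mem_of_res_block_mem[OF B xc])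
        fix i assume i: "i < k"
        show "res (block i) x \<in> B"
        proof (cases "i \<in> zeros H")
          case True
          then have "i < m" "i \<in> zeros A" using zA by (auto simp: zeros_def)
          then have "coord x c s = 0" if "c \<in> block i" for c s
            using that x coord_trivial[OF xc w_odd_small] by (auto simp: block_iff zeros_def)
          then have "res (block i) x = \<one>\<^bsub>G\<^esub>" by (intro coord_eqI) simp
          then show ?thesis using closed_subgroup_one[OF B] by simp
        next
          case False
          obtain h where h: "h \<in> B" "red (Suc R) x = red (Suc R) h"
            using AB x by (metis imageE imageI)
          have "block_nbhd i (Suc R) \<subseteq> B" using RB[OF i False] block_nbhd_antimono[of R "Suc R" i] by auto
          then show ?thesis using res_mem_of_red_eq[OF B _ i xc h] by blast
        qed
      qed
    qed
    show "K = H"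
      using sub[OF Kc H z RH e] sub[OF H Kc refl RK e[symmetric]] by blast
  qed
  then show ?thesis by blast
qed

section \<open>Approximating non-isolated subgroups\<close>

lemma perturb_zero_coord:
  assumes H: "H \<in> closed_subgroups G T" and w: "w c > 1" and z: "\<And>x r. x \<in> H \<Longrightarrow> coord x c r = 0"
  obtains K where "K \<in> closed_subgroups G T" "K \<noteq> H" "red s ` K = red s ` H" "H \<subseteq> K"
    "\<And>x. x \<in> K \<Longrightarrow> res (- {c}) x \<in> H"
proof
  define K where "K = {x \<in> carrier G. res (- {c}) x \<in> H} \<inter> {x \<in> carrier G. coord x c s = 0}"
  show Kc: "K \<in> closed_subgroups G T"
    unfolding K_def
    by (intro closed_subgroups_Int closed_subgroups_vimage H res_hom red_res closed_subgroup_coord_zero)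
  show res: "res (- {c}) x \<in> H" if "x \<in> K" for x using that by (simp add: K_def)
  show HK: "H \<subseteq> K"
  proof
    fix x assume x: "x \<in> H"
    then have "res (- {c}) x = x" using z by (intro coord_eqI) auto
    then show "x \<in> K" using x z closed_subgroup_subset[OF H] by (simp add: K_def)
  qed
  have "red s ` K \<subseteq> red s ` H"
  proof (rule image_subsetI)
    fix x assume x: "x \<in> K"
    then have "red s x = red s (res (- {c}) x)" by (auto simp: K_def red_def fun_eq_iff)
    then show "red s x \<in> red s ` H" using res[OF x] by (rule image_eqI)
  qed
  then show "red s ` K = red s ` H" by (rule equalityI) (rule image_mono[OF HK])
  have "res (- {c}) (prime_power_at c s) = \<one>\<^bsub>G\<^esub>" by (rule coord_eqI) auto
  then have "prime_power_at c s \<in> K" using closed_subgroup_one[OF H] by (simp add: K_def)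
  moreover have "prime_power_at c s \<notin> H" using z coord_prime_power_at_nonzero[OF w] by blast
  ultimately show "K \<noteq> H" by blast
qed

text \<open>If component \<open>i\<close> of \<open>H\<close> is trivial, enlarging it in one of its
  two coordinates leaves it non-open. Otherwise \<open>H\<close> is pulled back along a transvection
  congruent to the identity modulo \<open>P i ^ s\<close>; if the transvections in both directions
  fixed \<open>H\<close>, then \<open>H\<close> would contain nonzero elements of each coordinate
  line and so be open at \<open>i\<close>.\<close>

lemma not_open_at_perturb:
  assumes H: "H \<in> closed_subgroups G T" and i: "m \<le> i" "i < k" and no: "\<not> open_at H i"
  obtains K where "K \<in> closed_subgroups G T" "K \<noteq> H" "red s ` K = red s ` H" "\<not> open_at K i"
proof (cases "\<forall>x\<in>H. \<forall>c\<in>block i. \<forall>r. coord x c r = 0")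
  case True
  have w1: "w (2 * i) > 1" "w (Suc (2 * i)) > 1" using i P_gt_1 by (auto simp: w_even w_odd)
  obtain K where K: "K \<in> closed_subgroups G T" "K \<noteq> H" "red s ` K = red s ` H"
    "\<And>x. x \<in> K \<Longrightarrow> res (- {2 * i}) x \<in> H"
    by (rule perturb_zero_coord[OF H w1(1), of s]) (use True in \<open>auto simp: block_iff\<close>)
  have "coord x (Suc (2 * i)) r = 0" if "x \<in> K" for x r
  proof -
    have "Suc (2 * i) \<in> block i" by (simp add: block_iff)
    then have "coord (res (- {2 * i}) x) (Suc (2 * i)) r = 0"
      using K(4)[OF that] True by blast
    then show ?thesis by simp
  qed
  then have "\<not> open_at K i" using w1(2) by (intro not_open_at[of "Suc (2 * i)"]) (auto simp: block_iff)
  then show ?thesis using that K by blast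
next
  case False
  then obtain x d v where x: "x \<in> H" "d \<in> block i" "coord x d v \<noteq> 0" by blast
  define d' where "d' = (if d = 2 * i then Suc (2 * i) else 2 * i)"
  have dd': "d \<noteq> d'" "w d = P i" "w d' = P i" "block i = {d, d'}"
    using x(2) i by (auto simp: d'_def block_iff w_even w_odd)
  define t where "t = int (P i) ^ s"
  define shear where "shear = (\<lambda>c c' x. x \<otimes>\<^bsub>G\<^esub> transvect c c' t x)"
  \<comment> \<open>A preimage rather than an image, so that closedness is immediate; the inverse
    shear shows that reduction and non-openness are inherited from \<open>H\<close>.\<close>
  define K where "K = (\<lambda>c c'. {x \<in> carrier G. shear c c' x \<in> H})"
  have Kprops: "K c c' \<in> closed_subgroups G T" "red s ` K c c' = red s ` H" "\<not> open_at (K c c') i"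
    if c: "c \<in> block i" "c' \<in> block i" "c \<noteq> c'" "w c = P i" "w c' = P i" for c c'
  proof -
    have ww: "w c = w c'" using c by simp
    show "K c c' \<in> closed_subgroups G T"
      unfolding K_def shear_def
      by (rule closed_subgroups_vimage[OF H shear_hom[OF ww]]) (intro red_mult red_transvect)
    have inv: "x \<otimes>\<^bsub>G\<^esub> transvect c c' (- t) x \<in> K c c'" "shear c c' (x \<otimes>\<^bsub>G\<^esub> transvect c c' (- t) x) = x"
      if "x \<in> H" for x
      using shear_inverse[OF closed_subgroup_subset[OF H that] ww c(3), of t] that
        closed_subgroup_subset[OF H that] ww by (auto simp: K_def shear_def)
    show "red s ` K c c' = red s ` H"
    proof (intro equalityI subsetI)
      fix f assume "f \<in> red s ` K c c'"
      then obtain x where x: "x \<in> K c c'" "f = red s x" by blast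
      then have "f = red s (shear c c' x)"
        unfolding shear_def by (subst red_shear) (use ww c in \<open>auto simp: K_def t_def\<close>)
      then show "f \<in> red s ` H" using x by (auto simp: K_def)
    next
      fix f assume "f \<in> red s ` H"
      then obtain x where x: "x \<in> H" "f = red s x" by blast
      then have "f = red s (x \<otimes>\<^bsub>G\<^esub> transvect c c' (- t) x)"
        by (subst red_shear) (use ww c closed_subgroup_subset[OF H] in \<open>auto simp: t_def\<close>)
      then show "f \<in> red s ` K c c'" using inv(1)[OF x(1)] by blast
    qed
    show "\<not> open_at (K c c') i"
    proof
      assume "open_at (K c c') i"
      then obtain r where r: "block_nbhd i r \<subseteq> K c c'" by (auto simp: open_at_def)
      have "block_nbhd i r \<subseteq> H"
      proof
        fix y assume y: "y \<in> block_nbhd i r"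
        then have yc: "y \<in> carrier G" by (simp add: block_nbhd_def)
        have "y \<otimes>\<^bsub>G\<^esub> transvect c c' (- t) y \<in> block_nbhd i r" using y c ww by (auto simp: block_nbhd_def)
        then have "shear c c' (y \<otimes>\<^bsub>G\<^esub> transvect c c' (- t) y) \<in> H" using r by (auto simp: K_def)
        then show "y \<in> H"
          using shear_inverse[OF yc ww c(3), of t] by (simp add: shear_def)
      qed
      then show False using no by (auto simp: open_at_def)
    qed
  qed
  have "K d d' \<noteq> H \<or> K d' d \<noteq> H"
  proof (rule ccontr)
    assume "\<not> (K d d' \<noteq> H \<or> K d' d \<noteq> H)"
    then have KH: "K d d' = H" "K d' d = H" by auto
    have transvectH: "transvect c c' t y \<in> H" if "K c c' = H" "w c = w c'" "y \<in> H" for c c' y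
    proof -
      have yc: "y \<in> carrier G" using closed_subgroup_subset[OF H] that by blast
      have "shear c c' y \<in> H" using that by (auto simp: K_def)
      then have "inv\<^bsub>G\<^esub> y \<otimes>\<^bsub>G\<^esub> shear c c' y \<in> H"
        using closed_subgroup_mult[OF H] closed_subgroup_inv[OF H] that(3) by blast
      moreover have "inv\<^bsub>G\<^esub> y \<otimes>\<^bsub>G\<^esub> shear c c' y = transvect c c' t y"
        using yc that(2) by (simp add: shear_def flip: G.m_assoc)
      ultimately show ?thesis by simp
    qed
    \<comment> \<open>Multiplying by \<open>t = P i ^ s\<close> raises the valuation by
      \<open>s\<close>, so a residue nonzero at level \<open>u\<close> stays nonzero at level
      \<open>u + s\<close>.\<close>
    have nz: "coord (transvect c c' t y) c (u + s) \<noteq> 0"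
      if "coord y c' u \<noteq> 0" "w c = P i" "w c' = P i" "y \<in> carrier G" for c c' u y
    proof
      assume "coord (transvect c c' t y) c (u + s) = 0"
      then have "int (P i) ^ s * int (P i) ^ u dvd int (P i) ^ s * coord y c' (u + s)"
        using that by (auto simp: t_def power_add mult.commute)
      then have "q c' u dvd coord y c' (u + s)"
        using P_gt_1[of i] that by simp
      then have "coord y c' u = 0"
        using coord_mod_le[OF that(4), of u "u + s" c'] by auto
      then show False using that(1) by simp
    qed
    \<comment> \<open>Both elements live in a single coordinate: \<open>y\<close> carries
      \<open>t\<close> times coordinate \<open>d\<close> of \<open>x\<close> in place
      \<open>d'\<close>, and \<open>y'\<close> carries this, times \<open>t\<close> again, back to
      \<open>d\<close>.\<close>
    define y where "y = transvect d' d t x"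
    define y' where "y' = transvect d d' t y"
    have xc: "x \<in> carrier G" using closed_subgroup_subset[OF H x(1)] .
    have y: "y \<in> H" "y \<in> carrier G" "coord y d' (v + s) \<noteq> 0" "\<And>c r. c \<noteq> d' \<Longrightarrow> coord y c r = 0"
      using transvectH[OF KH(2) _ x(1)] dd' nz[OF x(3) dd'(3,2) xc] xc unfolding y_def by simp_all
    have y': "y' \<in> H" "coord y' d (v + s + s) \<noteq> 0" "\<And>c r. c \<noteq> d \<Longrightarrow> coord y' c r = 0"
      using transvectH[OF KH(1) _ y(1)] dd' nz[OF y(3) dd'(2,3) y(2)] unfolding y'_def by simp_all
    \<comment> \<open>\<open>cyclic_open\<close> applies in \<open>d'\<close> from level
      \<open>v + s\<close> and in \<open>d\<close> from level \<open>v + s + s\<close>; the larger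
      one does for both.\<close>
    have "block_nbhd i (v + s + s) \<subseteq> H"
    proof
      fix z assume z: "z \<in> block_nbhd i (v + s + s)"
      then have zc: "z \<in> carrier G" by (simp add: block_nbhd_def)
      have z': "coord z c (v + s) = 0" for c
        using z block_nbhd_antimono[of "v + s" "v + s + s" i] by (auto simp: block_nbhd_def)
      have "res {d} z \<in> H"
        by (rule cyclic_open[OF H y'(1), of d "v + s + s"])
          (use y' prime_P dd' z zc in \<open>auto simp: block_nbhd_def\<close>)
      moreover have "res {d'} z \<in> H"
        by (rule cyclic_open[OF H y(1), of d' "v + s"])
          (use y prime_P dd' z' zc in auto)
      moreover have "z = res {d} z \<otimes>\<^bsub>G\<^esub> res {d'} z"
      proof (rule coord_eqI)
        fix c r
        have "coord z c r = 0" if "c \<noteq> d" "c \<noteq> d'"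
          using z that unfolding block_nbhd_def dd'(4) by blast
        then show "coord z c r = coord (res {d} z \<otimes>\<^bsub>G\<^esub> res {d'} z) c r"
          using dd'(1) coord_mod[OF zc, of c r] by (cases "c = d"; cases "c = d'") simp_all
      qed
      ultimately show "z \<in> H" using closed_subgroup_mult[OF H] by metis
    qed
    then show False using no by (auto simp: open_at_def)
  qed
  then show ?thesis
    using that[of "K d d'"] that[of "K d' d"] Kprops[of d d'] Kprops[of d' d] dd' by auto
qed

section \<open>Iterated derivatives and the height\<close>

lemma remove_isolated_cb_stage: "remove_isolated (subgroup_space G T) (cb_stage t) = cb_stage (Suc t)"
proof -
  have Dc: "cb_stage t \<subseteq> closed_subgroups G T" for t by (auto simp: cb_stage_def)
  have mono: "cb_stage (Suc t) \<subseteq> cb_stage t" by (auto simp: cb_stage_def)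
  have "H \<in> isolated_points (subgroup_space G T) (cb_stage t)" if "H \<in> cb_stage t" "H \<notin> cb_stage (Suc t)" for H
  proof -
    have H: "H \<in> closed_subgroups G T" "\<And>i. m \<le> i \<Longrightarrow> i < k \<Longrightarrow> open_at H i" "card (zeros H) = t"
      using that by (auto simp: cb_stage_def)
    show ?thesis using isolated_iff[OF Dc] isolated_if_open_at[OF H(1,2)] H(3) that(1) by simp
  qed
  moreover have "H \<notin> isolated_points (subgroup_space G T) (cb_stage t)" if HD: "H \<in> cb_stage (Suc t)" for H
  proof -
    have H: "H \<in> closed_subgroups G T" using HD by (simp add: cb_stage_def)
    have "\<exists>K\<in>cb_stage t. red s ` K = red s ` H \<and> K \<noteq> H" for s
    proof (cases "\<exists>i. m \<le> i \<and> i < k \<and> \<not> open_at H i")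
      case True
      then obtain i where i: "m \<le> i" "i < k" "\<not> open_at H i" by blast
      obtain K where "K \<in> closed_subgroups G T" "K \<noteq> H" "red s ` K = red s ` H" "\<not> open_at K i"
        by (rule not_open_at_perturb[OF H i])
      then show ?thesis using i by (auto simp: cb_stage_def)
    next
      case False
      then have c: "Suc t \<le> card (zeros H)" using HD by (auto simp: cb_stage_def)
      then obtain i where i: "i \<in> zeros H" by fastforce
      then have "i < k" using m_le by (simp add: zeros_def)
      then have w: "w (2 * i) > 1" using P_gt_1 by (simp add: w_even)
      obtain K where K: "K \<in> closed_subgroups G T" "K \<noteq> H" "red s ` K = red s ` H"
        "\<And>x. x \<in> K \<Longrightarrow> res (- {2 * i}) x \<in> H"
        by (rule perturb_zero_coord[OF H w, of s]) (use i in \<open>auto simp: zeros_def\<close>)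
      have "zeros H - {i} \<subseteq> zeros K"
      proof
        fix j assume j: "j \<in> zeros H - {i}"
        have "coord x (2 * j) r = 0" if "x \<in> K" for x r
        proof -
          have "coord (res (- {2 * i}) x) (2 * j) r = 0" using K(4)[OF that] j by (auto simp: zeros_def)
          then show ?thesis using j by simp
        qed
        then show "j \<in> zeros K" using j by (auto simp: zeros_def)
      qed
      then have "card (zeros H - {i}) \<le> card (zeros K)" by (rule card_mono[rotated]) simp
      then have "t \<le> card (zeros K)" using c i by simp
      then show ?thesis using K by (auto simp: cb_stage_def)
    qed
    then show ?thesis unfolding isolated_iff[OF Dc] by blast
  qed
  ultimately show ?thesis unfolding remove_isolated_def using mono by blast
qed

lemma cb_derivative_eq_cb_stage: "cb_derivative (subgroup_space G T) t = cb_stage t" for t :: nat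
proof (induction t)
  case 0
  show ?case
    by (simp add: cb_derivative_0 topspace_subgroup_space[OF G.group_axioms topspace_T] cb_stage_def)
next
  case (Suc t)
  then show ?case by (simp add: cb_derivative_Suc remove_isolated_cb_stage)
qed

text \<open>The witness is trivial in the first \<open>t\<close> factors Z_p, which exist as
  \<open>t \<le> m\<close>, and full elsewhere, so it has exactly \<open>t\<close> trivial
  components.\<close>

lemma cb_stage_neq_Suc:
  assumes "t \<le> m"
  shows "cb_stage t \<noteq> cb_stage (Suc t)"
proof -
  define C where "C = {c. even c \<and> c < 2 * t}"
  define H where "H = {x \<in> carrier G. res C x \<in> {\<one>\<^bsub>G\<^esub>}}"
  have Hc: "H \<in> closed_subgroups G T" unfolding H_def
    by (intro closed_subgroups_vimage closed_subgroup_trivial res_hom red_res)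
  have H: "x \<in> H \<longleftrightarrow> x \<in> carrier G \<and> (\<forall>c\<in>C. \<forall>r. coord x c r = 0)" for x
  proof
    assume x: "x \<in> H"
    then have "coord (res C x) c r = 0" for c r by (simp add: H_def)
    then have "coord x c r = 0" if "c \<in> C" for c r using that by (metis coord_res)
    then show "x \<in> carrier G \<and> (\<forall>c\<in>C. \<forall>r. coord x c r = 0)" using x by (simp add: H_def)
  next
    assume "x \<in> carrier G \<and> (\<forall>c\<in>C. \<forall>r. coord x c r = 0)"
    moreover from this have "res C x = \<one>\<^bsub>G\<^esub>" by (intro coord_eqI) auto
    ultimately show "x \<in> H" by (simp add: H_def)
  qed
  have LH: "block_nbhd i 0 \<subseteq> H" if "t \<le> i" for i
    using that by (auto simp: block_nbhd_def H C_def block_def)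
  have "open_at H i" if "t \<le> i" for i using LH[OF that] by (auto simp: open_at_def)
  moreover from this have "zeros H = {..<t}"
    using zeros_not_open_at[of _ H] assms by (auto simp: zeros_def H C_def) (meson not_le zeros_not_open_at)
  ultimately have "H \<in> cb_stage t" "H \<notin> cb_stage (Suc t)" using Hc assms by (auto simp: cb_stage_def)
  then show ?thesis by blast
qed

text \<open>There are only \<open>m\<close> factors Z_p, so from stage \<open>Suc m\<close> on the
  count condition fails and just the subgroups with a non-open component in some Z_p x Z_p remain;
  for \<open>m = k\<close> there are none.\<close>

lemma height: "has_scattered_height (subgroup_space G T) (Suc m)"
proof -
  have "card (zeros H) \<le> m" for H
    using card_mono[of "{..<m}" "zeros H"] by (auto simp: zeros_def)
  then have "cb_stage (Suc m) = cb_stage (Suc (Suc m))"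
    by (auto simp: cb_stage_def) (metis Suc_n_not_le_n order_trans)+
  then show ?thesis
    unfolding has_scattered_height_def cb_derivative_eq_cb_stage remove_isolated_cb_stage
    using cb_stage_neq_Suc by auto
qed

lemma infinite_primes_eq: "infinite_primes (profinite_order G T) = P ` {..<k}"
proof (intro equalityI subsetI)
  fix p assume p: "p \<in> infinite_primes (profinite_order G T)"
  then have "prime p" "profinite_order G T p \<noteq> 0" by (auto simp: infinite_primes_def)
  then obtain c where c: "p dvd w c" using profinite_order_eq_0 by blast
  then have "c div 2 < k \<and> w c = P (c div 2)"
    using \<open>prime p\<close> by (auto simp: weight_def split: if_splits)
  then show "p \<in> P ` {..<k}"
    using c \<open>prime p\<close> prime_P by (metis primes_dvd_imp_eq image_eqI lessThan_iff)
next
  fix p assume "p \<in> P ` {..<k}"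
  then obtain i where i: "i < k" "p = P i" by blast
  then show "p \<in> infinite_primes (profinite_order G T)"
    using prime_P profinite_order_eq_infinity[of p "2 * i"] by (simp add: infinite_primes_def w_even)
qed

end

theorem theorem5p1:
  fixes k n :: nat
  assumes "1 \<le> n" and "n \<le> k + 1"
  shows "\<exists>(G :: (nat \<Rightarrow> int) monoid) (T :: (nat \<Rightarrow> int) topology).
           profinite_group G T \<and>
           finite (infinite_primes (profinite_order G T)) \<and>
           card (infinite_primes (profinite_order G T)) = k \<and>
           has_scattered_height (subgroup_space G T) n"
proof -
  obtain P :: "nat \<Rightarrow> nat" where P: "inj P" "range P \<subseteq> {p. prime p}"
    using infinite_countable_subset[OF primes_infinite] by blast
  \<comment> \<open>With \<open>m = n - 1\<close> the bounds on \<open>n\<close> give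
    \<open>m \<le> k\<close> and turn the height \<open>Suc m\<close> into \<open>n\<close>.\<close>
  interpret padic_product P "n - 1" k
    using P assms by unfold_locales auto
  have "card (P ` {..<k}) = k"
    using P(1) by (simp add: card_image inj_on_subset)
  then show ?thesis
    using profinite height infinite_primes_eq assms
    by (intro exI[of _ "adic_group (weight P (n - 1) k)"] exI[of _ "adic_topology (weight P (n - 1) k)"]) simp
qed

end
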